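(* Let $G$ be a group and let $\rho$ and $\rho'$ be 2-representations of $G$ in $2Vect_{\mathbb{C}}$, with 2-characters $\chi_\rho$ and $\chi_{\rho'}$. Then for every pair $g,h\in G$ with $gh=hg$, $$\chi_{\rho\oplus\rho'}(g,h)=\chi_\rho(g,h)+\chi_{\rho'}(g,h)\qquad\text{and}\qquad \chi_{\rho\otimes\rho'}(g,h)=\chi_\rho(g,h)\,\chi_{\rho'}(g,h).$$
   Context: **2-vector spaces.** For a field $k$, the 2-category $2Vect_k$ has objects $[n]$, $n\in\{0,1,2,\dots\}$; 1-morphisms are 2-matrices, i.e. matrices whose entries are $k$-vector spaces (an endomorphism of $[n]$ is an $n\times n$ 2-matrix), composed by matrix multiplication using $\oplus$ and $\otimes$ (with the usual canonical isomorphisms treated as identities); 2-morphisms $A\Rightarrow B$ between 2-matrices of the same size are matrices of linear maps $A_{ij}\to B_{ij}$. The identity $\mathbf 1_{[n]}$ has $k$ on the diagonal and $0$ elsewhere. Write $\cdot$ or juxtaposition for the (entrywise) composition of 2-morphisms and $\circ$ for composition of 1-morphisms and whiskering. **2-representations.** A 2-representation of $G$ in $2Vect_k$ consists of an object $[n]$ ($n$ is the dimension), 1-morphisms $\rho_g:[n]\to[n]$ for $g\in G$, a 2-isomorphism $\phi_1:\rho_1\Rightarrow\mathbf 1_{[n]}$, and 2-isomorphisms $\phi_{g,h}:\rho_g\circ\rho_h\Rightarrow\rho_{gh}$ for $g,h\in G$, such that $\phi_{gh,l}(\phi_{g,h}\circ\rho_l)=\phi_{g,hl}(\rho_g\circ\phi_{h,l})$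 for all $g,h,l\in G$, and $\phi_{1,g}=\phi_1\circ\rho_g$, $\phi_{g,1}=\rho_g\circ\phi_1$ for all $g\in G$. **Direct sum and tensor product.** In $2Vect_k$: $[n]\oplus[m]=[n+m]$, and $\oplus$ on 1-morphisms and 2-morphisms is block sum of 2-matrices, respectively of matrices of linear maps. $[n]\otimes[n']=[nn']$, with the $nn'$ indices labeled by pairs $(i,i')$ in lexicographic order; $f\otimes f'$ is the 2-matrix with $((i,i'),(j,j'))$-entry $f_{ij}\otimes f'_{i'j'}$, and similarly on 2-morphisms. The direct sum $\rho\oplus\rho'$ and tensor product $\rho\otimes\rho'$ of 2-representations are obtained by applying these operations to the objects, the 1-morphisms $\rho_g,\rho'_g$, and the 2-isomorphisms $\phi_{g,h},\phi'_{g,h}$ and $\phi_1,\phi_1'$. **2-character.** The categorical trace of a 1-endomorphism $F:[n]\to[n]$ is the vector space $\mathbb{T}r(F)=2Hom(\mathbf 1_{[n]},F)$ $(=\bigoplus_i F_{ii})$. For $g,h\in G$ the linear map $\psi_g(h):\mathbb{T}r(\rho_h)\to\mathbb{T}r(\rho_{ghg^{-1}})$ sends $\varphi:\mathbf 1_{[n]}\Rightarrow\rho_h$ to $$\phi_{g,h,g^{-1}}\cdot(\rho_g\circ\varphi\circ\rho_{g^{-1}})\cdot\phi_{g,g^{-1}}^{-1}\cdot\phi_1^{-1},\qquad \phi_{g,h,g^{-1}}=\phi_{g,hg^{-1}}(\rho_g\circ\phi_{h,g^{-1}}):\rho_g\circ\rho_h\circ\rho_{g^{-1}}\Rightarrow\rho_{ghg^{-1}}.$$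 If $gh=hg$, this is an endomorphism of $\mathbb{T}r(\rho_h)$, and the 2-character is $\chi_\rho(g,h)=\operatorname{trace}\bigl(\psi_g(h):\mathbb{T}r(\rho_h)\to\mathbb{T}r(\rho_h)\bigr)$. *)

theory Defs
  imports Complex_Main "HOL-Algebra.Group" "HOL-Library.Function_Algebras" "HOL-Library.Poly_Mapping"
begin

section \<open>Complex vector spaces\<close>

text \<open>
  A vector space is a linear subspace of an arbitrary ambient type of class \<open>complex_vector\<close>.
  Every set-indexed family of vector spaces embeds in a single ambient space (its direct sum), and no
  finiteness condition is imposed.
\<close>

class complex_vector = ab_group_add +
  fixes scaleC :: "complex \<Rightarrow> 'a \<Rightarrow> 'a"  (infixr \<open>*\<^sub>C\<close> 75)
  assumes scaleC_add_right: "c *\<^sub>C (x + y) = c *\<^sub>C x + c *\<^sub>C y"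
    and scaleC_add_left: "(c + d) *\<^sub>C x = c *\<^sub>C x + d *\<^sub>C x"
    and scaleC_scaleC: "c *\<^sub>C d *\<^sub>C x = (c * d) *\<^sub>C x"
    and scaleC_one: "1 *\<^sub>C x = x"

global_interpretation complex_vector: vector_space "scaleC :: complex \<Rightarrow> 'a \<Rightarrow> 'a :: complex_vector"
  defines csubspace = complex_vector.subspace
    and cspan = complex_vector.span
    and cdependent = complex_vector.dependent
    and crepresentation = complex_vector.representation
  by unfold_locales (simp_all add: scaleC_add_right scaleC_add_left scaleC_scaleC scaleC_one)

instantiation complex :: complex_vector
begin
definition scaleC_complex :: "complex \<Rightarrow> complex \<Rightarrow> complex" where "c *\<^sub>C x = c * x"
instance by standard (simp_all add: scaleC_complex_def algebra_simps)
end

instantiation "fun" :: (type, complex_vector) complex_vector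
begin
definition scaleC_fun :: "complex \<Rightarrow> ('a \<Rightarrow> 'b) \<Rightarrow> 'a \<Rightarrow> 'b" where "c *\<^sub>C f = (\<lambda>x. c *\<^sub>C f x)"
instance
  by standard (simp_all add: scaleC_fun_def fun_eq_iff scaleC_add_right scaleC_add_left
      scaleC_scaleC scaleC_one)
end

instantiation poly_mapping :: (type, complex_vector) complex_vector
begin
lift_definition scaleC_poly_mapping :: "complex \<Rightarrow> ('a \<Rightarrow>\<^sub>0 'b) \<Rightarrow> 'a \<Rightarrow>\<^sub>0 'b" is "\<lambda>c f x. c *\<^sub>C f x"
  by (rule finite_subset[rotated]) auto
instance
  by (standard; transfer)
    (simp_all add: fun_eq_iff scaleC_add_right scaleC_add_left scaleC_scaleC scaleC_one)
end

definition linear_on :: "'a::complex_vector set \<Rightarrow> 'b::complex_vector set \<Rightarrow> ('a \<Rightarrow> 'b) \<Rightarrow> bool" where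
  "linear_on V W f \<longleftrightarrow> (\<forall>x\<in>V. f x \<in> W) \<and> (\<forall>x\<in>V. \<forall>y\<in>V. f (x + y) = f x + f y)
     \<and> (\<forall>c. \<forall>x\<in>V. f (c *\<^sub>C x) = c *\<^sub>C f x)"

text \<open>
  The trace of an endomorphism of \<open>V\<close>, computed in some basis (independent of its choice);
  the sum is 0 by convention if \<open>V\<close> is infinite dimensional.
\<close>
definition linear_trace :: "'a::complex_vector set \<Rightarrow> ('a \<Rightarrow> 'a) \<Rightarrow> complex" where
  "linear_trace V f =
    (let B = (SOME B. \<not> cdependent B \<and> cspan B = V) in \<Sum>b\<in>B. crepresentation B (f b) b)"


section \<open>Tensor products\<close>

abbreviation free_gen :: "'a \<Rightarrow> 'b \<Rightarrow> ('a \<times> 'b) \<Rightarrow>\<^sub>0 complex" where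
  "free_gen v w \<equiv> Poly_Mapping.single (v, w) 1"

definition bilinear_relations ::
    "(('a::complex_vector \<times> 'b::complex_vector) \<Rightarrow>\<^sub>0 complex) set" where
  "bilinear_relations =
     {free_gen (v + v') w - free_gen v w - free_gen v' w | v v' w. True} \<union>
     {free_gen v (w + w') - free_gen v w - free_gen v w' | v w w'. True} \<union>
     {free_gen (c *\<^sub>C v) w - c *\<^sub>C free_gen v w | c v w. True} \<union>
     {free_gen v (c *\<^sub>C w) - c *\<^sub>C free_gen v w | c v w. True}"

definition tensor_rel ::
    "(('a::complex_vector \<times> 'b::complex_vector) \<Rightarrow>\<^sub>0 complex) \<Rightarrow> (('a \<times> 'b) \<Rightarrow>\<^sub>0 complex) \<Rightarrow> bool" where
  "tensor_rel x y \<longleftrightarrow> x - y \<in> cspan bilinear_relations"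

quotient_type (overloaded) ('a, 'b) tensor =
    "('a::complex_vector \<times> 'b::complex_vector) \<Rightarrow>\<^sub>0 complex" / tensor_rel
proof (rule equivpI)
  show "reflp tensor_rel"
    by (rule reflpI) (simp add: tensor_rel_def complex_vector.span_zero)
  show "symp tensor_rel"
    by (rule sympI) (use complex_vector.span_neg in \<open>fastforce simp: tensor_rel_def\<close>)
  show "transp tensor_rel"
    by (rule transpI) (use complex_vector.span_add in \<open>fastforce simp: tensor_rel_def\<close>)
qed

instantiation tensor :: (complex_vector, complex_vector) complex_vector
begin

lift_definition zero_tensor :: "('a, 'b) tensor" is 0 .

lift_definition plus_tensor :: "('a, 'b) tensor \<Rightarrow> ('a, 'b) tensor \<Rightarrow> ('a, 'b) tensor" is "(+)"
  unfolding tensor_rel_def by (drule (1) complex_vector.span_add) (simp add: algebra_simps)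

lift_definition uminus_tensor :: "('a, 'b) tensor \<Rightarrow> ('a, 'b) tensor" is uminus
  unfolding tensor_rel_def by (drule complex_vector.span_neg) (simp add: algebra_simps)

lift_definition minus_tensor :: "('a, 'b) tensor \<Rightarrow> ('a, 'b) tensor \<Rightarrow> ('a, 'b) tensor" is "(-)"
  unfolding tensor_rel_def by (drule (1) complex_vector.span_diff) (simp add: algebra_simps)

lift_definition scaleC_tensor :: "complex \<Rightarrow> ('a, 'b) tensor \<Rightarrow> ('a, 'b) tensor" is scaleC
  unfolding tensor_rel_def
  by (drule complex_vector.span_scale) (simp add: complex_vector.scale_right_diff_distrib)

instance
  by (standard; transfer)
    (simp_all add: tensor_rel_def complex_vector.span_zero algebra_simps
      scaleC_add_right scaleC_add_left scaleC_scaleC scaleC_one)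

end

lift_definition tensor_of :: "'a::complex_vector \<Rightarrow> 'b::complex_vector \<Rightarrow> ('a, 'b) tensor"
    (infixl \<open>\<otimes>\<^sub>v\<close> 72) is free_gen .

text \<open>
  For subspaces \<open>V\<close> and \<open>W\<close> of the ambient spaces, the natural map from their tensor product to the
  ambient one is injective, so the tensor product is the span of the elementary tensors.
\<close>
definition tensor_space ::
    "'a::complex_vector set \<Rightarrow> 'b::complex_vector set \<Rightarrow> ('a, 'b) tensor set" where
  "tensor_space V W = cspan {v \<otimes>\<^sub>v w | v w. v \<in> V \<and> w \<in> W}"

lemma csubspace_projection: assumes "csubspace V"
  obtains p where "linear_on UNIV UNIV p" "\<And>x. p x \<in> V" "\<And>x. x\<in>V \<Longrightarrow> p x = (x::'a::complex_vector)"
proof -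
  interpret cp: vector_space_pair "scaleC :: complex \<Rightarrow> 'a \<Rightarrow> 'a" "scaleC :: complex \<Rightarrow> 'a \<Rightarrow> 'a" ..
  have "Vector_Spaces.linear (*\<^sub>C) (*\<^sub>C) (\<lambda>x::'a. x)" using complex_vector.linear_id by (simp add: id_def)
  from cp.linear_exists_left_inverse_on[OF this assms[unfolded csubspace_def]] obtain g where g:
   "g ` UNIV \<subseteq> V" "Vector_Spaces.linear (*\<^sub>C) (*\<^sub>C) g" "\<forall>v\<in>V. g v = v" by auto
  interpret l: Vector_Spaces.linear "(*\<^sub>C)" "(*\<^sub>C)" g by fact
  show thesis
    by (rule that[of g]) (use g in \<open>auto simp: linear_on_def l.add l.scale\<close>)
qed

definition free_lift :: "('a::complex_vector \<Rightarrow> 'b::complex_vector \<Rightarrow> 'c::complex_vector) \<Rightarrow> (('a\<times>'b) \<Rightarrow>\<^sub>0 complex) \<Rightarrow> 'c"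
  where "free_lift \<gamma> r = (\<Sum>k\<in>Poly_Mapping.keys r. Poly_Mapping.lookup r k *\<^sub>C \<gamma> (fst k) (snd k))"

lemma free_lift_eq: assumes "finite S" "Poly_Mapping.keys r \<subseteq> S" shows "free_lift \<gamma> r = (\<Sum>k\<in>S. Poly_Mapping.lookup r k *\<^sub>C \<gamma> (fst k) (snd k))"
  unfolding free_lift_def by (rule sum.mono_neutral_left) (use assms in \<open>auto simp: in_keys_iff\<close>)

lemma free_lift_add: "free_lift \<gamma> (r+s) = free_lift \<gamma> r + free_lift \<gamma> s"
proof -
  let ?S = "Poly_Mapping.keys r \<union> Poly_Mapping.keys s"
  have "Poly_Mapping.keys (r+s) \<subseteq> ?S" by (rule Poly_Mapping.keys_add)
  then show ?thesis
    by (simp add: free_lift_eq[of ?S] lookup_add scaleC_add_left sum.distrib)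
qed

lemma free_lift_scale: "free_lift \<gamma> (c *\<^sub>C r) = c *\<^sub>C free_lift \<gamma> r"
proof -
  have "Poly_Mapping.keys (c *\<^sub>C r) \<subseteq> Poly_Mapping.keys r" by (auto simp: in_keys_iff scaleC_poly_mapping.rep_eq)
  then show ?thesis
    by (simp add: free_lift_eq[of "Poly_Mapping.keys r"] scaleC_poly_mapping.rep_eq scaleC_complex_def complex_vector.scale_sum_right scaleC_scaleC)
qed

lemma free_lift_diff: "free_lift \<gamma> (r-s) = free_lift \<gamma> r - free_lift \<gamma> s"
  by (simp add: eq_diff_eq flip: free_lift_add)

lemma free_lift_gen: "free_lift \<gamma> (free_gen v w) = \<gamma> v w"
  by (simp add: free_lift_def scaleC_one)

lemma tensor_lift_exists:
  assumes V: "csubspace V" and W: "csubspace W"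
   and b1: "\<And>w. w\<in>W \<Longrightarrow> linear_on V UNIV (\<lambda>v. \<beta> v w)"
   and b2: "\<And>v. v\<in>V \<Longrightarrow> linear_on W UNIV (\<beta> v)"
  shows "\<exists>f. linear_on (tensor_space V W) UNIV f \<and> (\<forall>v\<in>V. \<forall>w\<in>W. f (v \<otimes>\<^sub>v w) = \<beta> v w)"
proof -
  obtain p where p: "linear_on UNIV UNIV p" "\<And>x. p x \<in> V" "\<And>x. x\<in>V \<Longrightarrow> p x = x" using csubspace_projection[OF V] by metis
  obtain q where q: "linear_on UNIV UNIV q" "\<And>x. q x \<in> W" "\<And>x. x\<in>W \<Longrightarrow> q x = x" using csubspace_projection[OF W] by metis
  let ?g = "\<lambda>v w. \<beta> (p v) (q w)"
  have z: "free_lift ?g r = 0" if "r \<in> cspan bilinear_relations" for r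
    using that
  proof (induction rule: complex_vector.span_induct_alt)
    case base show ?case by (simp add: free_lift_def)
  next
    case (step c x y)
    have "free_lift ?g x = 0" using step(1) p q b1 b2
      by (auto simp: bilinear_relations_def free_lift_diff free_lift_scale free_lift_gen linear_on_def)
    then show ?case using step by (simp add: free_lift_add free_lift_scale)
  qed
  define f where "f t = free_lift ?g (rep_tensor t)" for t
  have fa: "f (abs_tensor r) = free_lift ?g r" for r
  proof -
    have "tensor_rel (rep_tensor (abs_tensor r)) r"
      using Quotient_rep_abs[OF Quotient_tensor] by (metis Quotient3_tensor rep_abs_rsp_left tensor.abs_eq_iff Quotient3_abs_rep)
    then have "free_lift ?g (rep_tensor (abs_tensor r) - r) = 0" unfolding tensor_rel_def by (rule z)
    then show ?thesis unfolding f_def by (simp add: free_lift_diff)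
  qed
  have "f (x+y) = f x + f y" for x y
    by (induct x rule: tensor.abs_induct, induct y rule: tensor.abs_induct) (simp add: plus_tensor.abs_eq fa free_lift_add)
  moreover have "f (c *\<^sub>C x) = c *\<^sub>C f x" for c x
    by (induct x rule: tensor.abs_induct) (simp add: scaleC_tensor.abs_eq fa free_lift_scale)
  moreover have "f (v \<otimes>\<^sub>v w) = \<beta> v w" if "v \<in>V" "w\<in>W" for v w
    using that p q by (simp add: tensor_of.abs_eq fa free_lift_gen)
  ultimately show ?thesis by (intro exI[of _ f]) (auto simp: linear_on_def)
qed

text \<open>
  The linear map on the tensor product induced by a map that is bilinear on \<open>V \<times> W\<close>
  (its values outside \<open>tensor_space V W\<close> are irrelevant); it exists by \<open>tensor_lift_exists\<close>, and is unique since
  the elementary tensors span.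
\<close>
definition tensor_lift ::
    "'a::complex_vector set \<Rightarrow> 'b::complex_vector set \<Rightarrow> ('a \<Rightarrow> 'b \<Rightarrow> 'c::complex_vector)
      \<Rightarrow> ('a, 'b) tensor \<Rightarrow> 'c" where
  "tensor_lift V W \<beta> =
     (SOME f. linear_on (tensor_space V W) UNIV f \<and> (\<forall>v\<in>V. \<forall>w\<in>W. f (v \<otimes>\<^sub>v w) = \<beta> v w))"

definition tensor_map ::
    "'a::complex_vector set \<Rightarrow> 'b::complex_vector set \<Rightarrow> ('a \<Rightarrow> 'c::complex_vector)
      \<Rightarrow> ('b \<Rightarrow> 'd::complex_vector) \<Rightarrow> ('a, 'b) tensor \<Rightarrow> ('c, 'd) tensor" where
  "tensor_map V W f g = tensor_lift V W (\<lambda>v w. f v \<otimes>\<^sub>v g w)"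


section \<open>2-matrices and their 2-morphisms\<close>

text \<open>
  A 2-matrix is indexed from 0, and only its entries with indices below the size matter. Likewise
  only the values of the component of a 2-morphism \<open>A \<Rightarrow> B\<close> on the entry of \<open>A\<close> matter, so 2-morphisms
  are compared by \<open>eq2\<close>. The canonical isomorphisms (associator, unitors, and compatibility of
  composition with direct sums and tensor products) are written out.
\<close>

type_synonym 'a mat2 = "nat \<Rightarrow> nat \<Rightarrow> 'a set"
type_synonym ('a, 'b) mor2 = "nat \<Rightarrow> nat \<Rightarrow> 'a \<Rightarrow> 'b"

definition is_mat2 :: "nat \<Rightarrow> 'a::complex_vector mat2 \<Rightarrow> bool" where
  "is_mat2 n A \<longleftrightarrow> (\<forall>i<n. \<forall>j<n. csubspace (A i j))"

definition is_mor2 ::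
    "nat \<Rightarrow> 'a::complex_vector mat2 \<Rightarrow> 'b::complex_vector mat2 \<Rightarrow> ('a, 'b) mor2 \<Rightarrow> bool" where
  "is_mor2 n A B \<sigma> \<longleftrightarrow> (\<forall>i<n. \<forall>j<n. linear_on (A i j) (B i j) (\<sigma> i j))"

definition is_iso2 ::
    "nat \<Rightarrow> 'a::complex_vector mat2 \<Rightarrow> 'b::complex_vector mat2 \<Rightarrow> ('a, 'b) mor2 \<Rightarrow> bool" where
  "is_iso2 n A B \<sigma> \<longleftrightarrow> is_mor2 n A B \<sigma> \<and> (\<forall>i<n. \<forall>j<n. bij_betw (\<sigma> i j) (A i j) (B i j))"

definition eq2 :: "nat \<Rightarrow> 'a mat2 \<Rightarrow> ('a, 'b) mor2 \<Rightarrow> ('a, 'b) mor2 \<Rightarrow> bool" where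
  "eq2 n A \<sigma> \<tau> \<longleftrightarrow> (\<forall>i<n. \<forall>j<n. \<forall>x\<in>A i j. \<sigma> i j x = \<tau> i j x)"

definition id2 :: "('a, 'a) mor2" where
  "id2 i j x = x"

definition vcomp :: "('b, 'c) mor2 \<Rightarrow> ('a, 'b) mor2 \<Rightarrow> ('a, 'c) mor2"  (infixr \<open>\<bullet>\<close> 55) where
  "(\<tau> \<bullet> \<sigma>) i j x = \<tau> i j (\<sigma> i j x)"

definition inv2 :: "'a mat2 \<Rightarrow> ('a, 'b) mor2 \<Rightarrow> ('b, 'a) mor2" where
  "inv2 A \<sigma> i j = inv_into (A i j) (\<sigma> i j)"

definition one2 :: "complex mat2" where
  "one2 i j = (if i = j then UNIV else {0})"

text \<open>The direct sum of the spaces \<open>A\<^sub>i\<^sub>k \<otimes> B\<^sub>k\<^sub>j\<close>, \<open>k < n\<close>, as a space of functions of \<open>k\<close>.\<close>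
definition comp2 ::
    "nat \<Rightarrow> 'a::complex_vector mat2 \<Rightarrow> 'b::complex_vector mat2 \<Rightarrow> (nat \<Rightarrow> ('a, 'b) tensor) mat2" where
  "comp2 n A B i j =
     {t. (\<forall>k<n. t k \<in> tensor_space (A i k) (B k j)) \<and> (\<forall>k\<ge>n. t k = 0)}"

text \<open>
  The horizontal composite of \<open>\<sigma>\<close> (with source \<open>A\<close>) and \<open>\<tau>\<close> (with source \<open>B\<close>); whiskering is the case
  where one of them is \<open>id2\<close>.
\<close>
definition hcomp ::
    "nat \<Rightarrow> 'a::complex_vector mat2 \<Rightarrow> 'b::complex_vector mat2
      \<Rightarrow> ('a, 'c::complex_vector) mor2 \<Rightarrow> ('b, 'd::complex_vector) mor2
      \<Rightarrow> (nat \<Rightarrow> ('a, 'b) tensor, nat \<Rightarrow> ('c, 'd) tensor) mor2" where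
  "hcomp n A B \<sigma> \<tau> i j t =
     (\<lambda>k. if k < n then tensor_map (A i k) (B k j) (\<sigma> i k) (\<tau> k j) (t k) else 0)"

definition coord_inj :: "nat \<Rightarrow> 'a::zero \<Rightarrow> nat \<Rightarrow> 'a" where
  "coord_inj l x = (\<lambda>k. if k = l then x else 0)"

text \<open>\<open>(a \<otimes> b) \<otimes> c \<mapsto> a \<otimes> (b \<otimes> c)\<close>\<close>
definition tensor_assoc ::
    "(('a::complex_vector, 'b::complex_vector) tensor, 'c::complex_vector) tensor
      \<Rightarrow> ('a, ('b, 'c) tensor) tensor" where
  "tensor_assoc = tensor_lift UNIV UNIV (\<lambda>s c. tensor_lift UNIV UNIV (\<lambda>a b. a \<otimes>\<^sub>v (b \<otimes>\<^sub>v c)) s)"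

text \<open>\<open>(A \<circ> B) \<circ> C \<Rightarrow> A \<circ> (B \<circ> C)\<close>: the summand \<open>(A\<^sub>i\<^sub>k \<otimes> B\<^sub>k\<^sub>l) \<otimes> C\<^sub>l\<^sub>j\<close> goes to \<open>A\<^sub>i\<^sub>k \<otimes> (B\<^sub>k\<^sub>l \<otimes> C\<^sub>l\<^sub>j)\<close>.\<close>
definition associator ::
    "nat \<Rightarrow> (nat \<Rightarrow> (nat \<Rightarrow> ('a::complex_vector, 'b::complex_vector) tensor, 'c::complex_vector) tensor,
      nat \<Rightarrow> ('a, nat \<Rightarrow> ('b, 'c) tensor) tensor) mor2" where
  "associator n i j t =
     (\<lambda>k. if k < n
       then \<Sum>l<n. tensor_map UNIV UNIV (\<lambda>a. a) (coord_inj l)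
              (tensor_assoc (tensor_map UNIV UNIV (\<lambda>s. s k) (\<lambda>c. c) (t l)))
       else 0)"

text \<open>\<open>1 \<circ> A \<Rightarrow> A\<close> and \<open>A \<circ> 1 \<Rightarrow> A\<close>; only the summand \<open>k = i\<close>, respectively \<open>k = j\<close>, is nonzero.\<close>
definition left_unitor :: "(nat \<Rightarrow> (complex, 'a::complex_vector) tensor, 'a) mor2" where
  "left_unitor i j t = tensor_lift UNIV UNIV (\<lambda>c x. c *\<^sub>C x) (t i)"

definition right_unitor :: "(nat \<Rightarrow> ('a::complex_vector, complex) tensor, 'a) mor2" where
  "right_unitor i j t = tensor_lift UNIV UNIV (\<lambda>x c. c *\<^sub>C x) (t j)"


section \<open>2-representations\<close>

text \<open>The data of a 2-representation: \<open>n\<close>, \<open>\<rho>\<^sub>g\<close>, \<open>\<phi>\<^sub>g\<^sub>,\<^sub>h\<close> and \<open>\<phi>\<^sub>1\<close>.\<close>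
record (overloaded) ('g, 'a) rep2 =
  rdim :: nat
  rmor :: "'g \<Rightarrow> 'a mat2"
  rphi :: "'g \<Rightarrow> 'g \<Rightarrow> (nat \<Rightarrow> ('a::complex_vector, 'a) tensor, 'a) mor2"
  rphi1 :: "('a, complex) mor2"

locale two_representation = group G for G (structure) +
  fixes \<rho> :: "('g, 'a::complex_vector) rep2"
  assumes mat2: "g \<in> carrier G \<Longrightarrow> is_mat2 (rdim \<rho>) (rmor \<rho> g)"
    and phi1_iso: "is_iso2 (rdim \<rho>) (rmor \<rho> \<one>) one2 (rphi1 \<rho>)"
    and phi_iso: "\<lbrakk>g \<in> carrier G; h \<in> carrier G\<rbrakk>
      \<Longrightarrow> is_iso2 (rdim \<rho>) (comp2 (rdim \<rho>) (rmor \<rho> g) (rmor \<rho> h)) (rmor \<rho> (g \<otimes> h)) (rphi \<rho> g h)"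
    and phi_assoc: "\<lbrakk>g \<in> carrier G; h \<in> carrier G; l \<in> carrier G\<rbrakk>
      \<Longrightarrow> eq2 (rdim \<rho>) (comp2 (rdim \<rho>) (comp2 (rdim \<rho>) (rmor \<rho> g) (rmor \<rho> h)) (rmor \<rho> l))
            (rphi \<rho> (g \<otimes> h) l
              \<bullet> hcomp (rdim \<rho>) (comp2 (rdim \<rho>) (rmor \<rho> g) (rmor \<rho> h)) (rmor \<rho> l) (rphi \<rho> g h) id2)
            (rphi \<rho> g (h \<otimes> l)
              \<bullet> hcomp (rdim \<rho>) (rmor \<rho> g) (comp2 (rdim \<rho>) (rmor \<rho> h) (rmor \<rho> l)) id2 (rphi \<rho> h l)
              \<bullet> associator (rdim \<rho>))"
    and phi_one_left: "g \<in> carrier G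
      \<Longrightarrow> eq2 (rdim \<rho>) (comp2 (rdim \<rho>) (rmor \<rho> \<one>) (rmor \<rho> g))
            (rphi \<rho> \<one> g)
            (left_unitor \<bullet> hcomp (rdim \<rho>) (rmor \<rho> \<one>) (rmor \<rho> g) (rphi1 \<rho>) id2)"
    and phi_one_right: "g \<in> carrier G
      \<Longrightarrow> eq2 (rdim \<rho>) (comp2 (rdim \<rho>) (rmor \<rho> g) (rmor \<rho> \<one>))
            (rphi \<rho> g \<one>)
            (right_unitor \<bullet> hcomp (rdim \<rho>) (rmor \<rho> g) (rmor \<rho> \<one>) id2 (rphi1 \<rho>))"


section \<open>2-characters\<close>

text \<open>2-morphisms \<open>A \<Rightarrow> B\<close> as a vector space; here they are normalised to vanish outside their domain.\<close>
definition restrict2 :: "nat \<Rightarrow> 'a mat2 \<Rightarrow> ('a, 'b::zero) mor2 \<Rightarrow> ('a, 'b) mor2" where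
  "restrict2 n A \<sigma> i j x = (if i < n \<and> j < n \<and> x \<in> A i j then \<sigma> i j x else 0)"

definition hom2 ::
    "nat \<Rightarrow> 'a::complex_vector mat2 \<Rightarrow> 'b::complex_vector mat2 \<Rightarrow> ('a, 'b) mor2 set" where
  "hom2 n A B = {\<sigma>. is_mor2 n A B \<sigma> \<and> restrict2 n A \<sigma> = \<sigma>}"

definition cat_trace :: "nat \<Rightarrow> 'a::complex_vector mat2 \<Rightarrow> (complex, 'a) mor2 set" where
  "cat_trace n F = hom2 n one2 F"

text \<open>
  The composite of the canonical isomorphism \<open>\<rho>\<^sub>g \<circ> \<rho>\<^sub>k \<cong> \<rho>\<^sub>g \<circ> (1 \<circ> \<rho>\<^sub>k)\<close>, where \<open>k\<close> is the inverse of \<open>g\<close>,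
  and of \<open>\<rho>\<^sub>g \<circ> \<sigma> \<circ> \<rho>\<^sub>k\<close> is bracketed as required by \<open>\<phi>\<^sub>g\<^sub>,\<^sub>h\<^sub>k (\<rho>\<^sub>g \<circ> \<phi>\<^sub>h\<^sub>,\<^sub>k)\<close>.
\<close>
definition psi ::
    "('g, 'm) monoid_scheme \<Rightarrow> ('g, 'a::complex_vector) rep2 \<Rightarrow> 'g \<Rightarrow> 'g
      \<Rightarrow> (complex, 'a) mor2 \<Rightarrow> (complex, 'a) mor2" where
  "psi G \<rho> g h \<sigma> =
    (let n = rdim \<rho>; R = rmor \<rho>; \<phi> = rphi \<rho>; k = inv\<^bsub>G\<^esub> g in
     restrict2 n one2
       (\<phi> g (h \<otimes>\<^bsub>G\<^esub> k) \<bullet> hcomp n (R g) (comp2 n (R h) (R k)) id2 (\<phi> h k)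
        \<bullet> hcomp n (R g) (comp2 n one2 (R k)) id2 (hcomp n one2 (R k) \<sigma> id2)
        \<bullet> hcomp n (R g) (R k) id2 (inv2 (comp2 n one2 (R k)) left_unitor)
        \<bullet> inv2 (comp2 n (R g) (R k)) (\<phi> g k)
        \<bullet> inv2 (R \<one>\<^bsub>G\<^esub>) (rphi1 \<rho>)))"

definition character2 ::
    "('g, 'm) monoid_scheme \<Rightarrow> ('g, 'a::complex_vector) rep2 \<Rightarrow> 'g \<Rightarrow> 'g \<Rightarrow> complex" where
  "character2 G \<rho> g h = linear_trace (cat_trace (rdim \<rho>) (rmor \<rho> h)) (psi G \<rho> g h)"


section \<open>Direct sums and tensor products of 2-representations\<close>

definition dsum_mat2 :: "nat \<Rightarrow> 'a::zero mat2 \<Rightarrow> 'a mat2 \<Rightarrow> 'a mat2" where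
  "dsum_mat2 n A A' i j =
     (if i < n \<and> j < n then A i j else if n \<le> i \<and> n \<le> j then A' (i - n) (j - n) else {0})"

definition dsum_mor2 :: "nat \<Rightarrow> ('a, 'b::zero) mor2 \<Rightarrow> ('a, 'b) mor2 \<Rightarrow> ('a, 'b) mor2" where
  "dsum_mor2 n \<sigma> \<sigma>' i j =
     (if i < n \<and> j < n then \<sigma> i j else if n \<le> i \<and> n \<le> j then \<sigma>' (i - n) (j - n) else (\<lambda>x. 0))"

text \<open>
  \<open>(A \<oplus> A') \<circ> (B \<oplus> B') \<Rightarrow> (A \<circ> B) \<oplus> (A' \<circ> B')\<close>, where \<open>A, B\<close> have size \<open>n\<close>: only the summands with
  \<open>k < n\<close> contribute to the first block, and only those with \<open>k \<ge> n\<close> to the second one.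
\<close>
definition dsum_interchange :: "nat \<Rightarrow> (nat \<Rightarrow> 'a::zero, nat \<Rightarrow> 'a) mor2" where
  "dsum_interchange n =
     dsum_mor2 n (\<lambda>i j t k. if k < n then t k else 0) (\<lambda>i j t k. t (n + k))"

text \<open>Here the block sum of two identity 2-matrices is \<open>one2\<close> on the nose.\<close>
definition dsum_rep :: "('g, 'a::complex_vector) rep2 \<Rightarrow> ('g, 'a) rep2 \<Rightarrow> ('g, 'a) rep2" where
  "dsum_rep \<rho> \<rho>' =
    (let n = rdim \<rho> in
     \<lparr>rdim = n + rdim \<rho>',
      rmor = (\<lambda>g. dsum_mat2 n (rmor \<rho> g) (rmor \<rho>' g)),
      rphi = (\<lambda>g h. dsum_mor2 n (rphi \<rho> g h) (rphi \<rho>' g h) \<bullet> dsum_interchange n),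
      rphi1 = dsum_mor2 n (rphi1 \<rho>) (rphi1 \<rho>')\<rparr>)"

text \<open>The pair \<open>(i, i')\<close> with \<open>i' < n'\<close> has position \<open>i * n' + i'\<close> in the lexicographic order.\<close>
definition tensor_mat2 ::
    "nat \<Rightarrow> 'a::complex_vector mat2 \<Rightarrow> 'b::complex_vector mat2 \<Rightarrow> ('a, 'b) tensor mat2" where
  "tensor_mat2 n' A A' p q = tensor_space (A (p div n') (q div n')) (A' (p mod n') (q mod n'))"

definition tensor_mor2 ::
    "nat \<Rightarrow> 'a::complex_vector mat2 \<Rightarrow> 'b::complex_vector mat2
      \<Rightarrow> ('a, 'c::complex_vector) mor2 \<Rightarrow> ('b, 'd::complex_vector) mor2
      \<Rightarrow> (('a, 'b) tensor, ('c, 'd) tensor) mor2" where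
  "tensor_mor2 n' A A' \<sigma> \<sigma>' p q =
     tensor_map (A (p div n') (q div n')) (A' (p mod n') (q mod n'))
       (\<sigma> (p div n') (q div n')) (\<sigma>' (p mod n') (q mod n'))"

text \<open>\<open>(a \<otimes> a') \<otimes> (b \<otimes> b') \<mapsto> (a \<otimes> b) \<otimes> (a' \<otimes> b')\<close>\<close>
definition tensor_middle_swap ::
    "(('a::complex_vector, 'c::complex_vector) tensor, ('b::complex_vector, 'd::complex_vector) tensor) tensor
      \<Rightarrow> (('a, 'b) tensor, ('c, 'd) tensor) tensor" where
  "tensor_middle_swap =
     tensor_lift UNIV UNIV (\<lambda>s u. tensor_lift UNIV UNIV (\<lambda>a a'.
       tensor_lift UNIV UNIV (\<lambda>b b'. (a \<otimes>\<^sub>v b) \<otimes>\<^sub>v (a' \<otimes>\<^sub>v b')) u) s)"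

text \<open>
  \<open>(A \<otimes> A') \<circ> (B \<otimes> B') \<Rightarrow> (A \<circ> B) \<otimes> (A' \<circ> B')\<close>, where \<open>A, B\<close> have size \<open>n\<close> and \<open>A', B'\<close> have size \<open>n'\<close>:
  the summand indexed by \<open>(k, k')\<close> goes to the tensor product of the summands indexed by \<open>k\<close> and \<open>k'\<close>.
\<close>
definition tensor_interchange ::
    "nat \<Rightarrow> nat \<Rightarrow>
      (nat \<Rightarrow> (('a::complex_vector, 'c::complex_vector) tensor, ('b::complex_vector, 'd::complex_vector) tensor) tensor,
       (nat \<Rightarrow> ('a, 'b) tensor, nat \<Rightarrow> ('c, 'd) tensor) tensor) mor2" where
  "tensor_interchange n n' p q t =
     (\<Sum>r<n * n'. tensor_map UNIV UNIV (coord_inj (r div n')) (coord_inj (r mod n'))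
        (tensor_middle_swap (t r)))"

text \<open>The tensor product of two identity 2-matrices is identified with \<open>one2\<close> by multiplication.\<close>
definition tensor_rep ::
    "('g, 'm) monoid_scheme \<Rightarrow> ('g, 'a::complex_vector) rep2 \<Rightarrow> ('g, 'b::complex_vector) rep2
      \<Rightarrow> ('g, ('a, 'b) tensor) rep2" where
  "tensor_rep G \<rho> \<rho>' =
    (let n = rdim \<rho>; n' = rdim \<rho>'; R = rmor \<rho>; R' = rmor \<rho>' in
     \<lparr>rdim = n * n',
      rmor = (\<lambda>g. tensor_mat2 n' (R g) (R' g)),
      rphi = (\<lambda>g h.
        tensor_mor2 n' (comp2 n (R g) (R h)) (comp2 n' (R' g) (R' h)) (rphi \<rho> g h) (rphi \<rho>' g h)
        \<bullet> tensor_interchange n n'),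
      rphi1 = (\<lambda>i j. tensor_lift UNIV UNIV (\<lambda>c d. c * d))
        \<bullet> tensor_mor2 n' (R \<one>\<^bsub>G\<^esub>) (R' \<one>\<^bsub>G\<^esub>) (rphi1 \<rho>) (rphi1 \<rho>')\<rparr>)"

end

theory Submission
  imports Defs
begin

text \<open>
  Since \<open>\<rho>\<^sub>g\<close> and \<open>\<rho>\<^sub>k\<close>, \<open>k\<close> the inverse of \<open>g\<close>, are mutually inverse 2-matrices, all their entries have dimension
  at most 1. In particular \<open>Tr(\<rho>\<^sub>h)\<close>, the direct sum of the \<open>(\<rho>\<^sub>h)\<^sub>i\<^sub>i\<close>, is finite dimensional, and the trace of
  \<open>\<psi>\<^sub>g(h)\<close> is the sum over \<open>i\<close> of its matrix entries on these lines. The \<open>i\<close>-th entry only involves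
  \<open>\<phi>\<^sub>1\<close>, the components of \<open>\<phi>\<close> at \<open>(i, i)\<close>, and the summand \<open>(\<rho>\<^sub>g)\<^sub>i\<^sub>i \<otimes> (\<rho>\<^sub>k)\<^sub>i\<^sub>i\<close> of \<open>(\<rho>\<^sub>g \<circ> \<rho>\<^sub>k)\<^sub>i\<^sub>i\<close>. For \<open>\<rho> \<oplus> \<rho>'\<close> the list
  of these entries is the concatenation of those for \<open>\<rho>\<close> and \<open>\<rho>'\<close>, and for \<open>\<rho> \<otimes> \<rho>'\<close> the entry
  at \<open>(i, i')\<close> is the product of the entries at \<open>i\<close> and \<open>i'\<close>.
\<close>

section \<open>Linear maps between subspaces\<close>

text \<open>No axiom bounds the dimension of an entry, and a trace over an infinite dimensional
  space is 0 by convention, so finiteness has to come from invertibility. Tensoring with a nonzero b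
  in \<open>R (inv g) j l\<close> embeds \<open>R g i j\<close> into the (i, l) entry of a composite
  isomorphic to the identity, that is, into the complex numbers or into 0. Such a b exists for some
  l because the (j, j) entry of the opposite composite is not 0. A line on the diagonal may vanish,
  so bases are replaced by frames: for every i a vector \<open>e i\<close> and a functional
  \<open>d i\<close> with x = d_i(x) e_i, both possibly 0. As a frame is indexed by all i, two
  frames concatenate or multiply in step with the index sets of the direct sum and of the tensor
  product. The definition of \<psi> contains inverses given by \<open>inv_into\<close>. They are not
  inverted for \<rho> \<oplus> \<rho>' and \<rho> \<otimes> \<rho>' directly: a candidate for the
  image of the unit is built from those of \<rho> and \<rho>' and recognised by its images under
  \<phi> and the unit isomorphism.\<close>

lemma linear_onI:
  assumes "\<And>x. x \<in> V \<Longrightarrow> f x \<in> W"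
    and "\<And>x y. x \<in> V \<Longrightarrow> y \<in> V \<Longrightarrow> f (x + y) = f x + f y"
    and "\<And>c x. x \<in> V \<Longrightarrow> f (c *\<^sub>C x) = c *\<^sub>C f x"
  shows "linear_on V W f"
  using assms unfolding linear_on_def by blast

lemma
  assumes "linear_on V W f"
  shows linear_on_mem: "x \<in> V \<Longrightarrow> f x \<in> W"
    and linear_on_add: "x \<in> V \<Longrightarrow> y \<in> V \<Longrightarrow> f (x + y) = f x + f y"
    and linear_on_scale: "x \<in> V \<Longrightarrow> f (c *\<^sub>C x) = c *\<^sub>C f x"
  using assms unfolding linear_on_def by blast+

lemma linear_on_mono: "linear_on V W f \<Longrightarrow> V' \<subseteq> V \<Longrightarrow> W \<subseteq> W' \<Longrightarrow> linear_on V' W' f"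
  unfolding linear_on_def by blast

lemma linear_on_compose:
  "linear_on U V f \<Longrightarrow> linear_on V W g \<Longrightarrow> linear_on U W (\<lambda>x. g (f x))"
  unfolding linear_on_def by simp

lemma linear_on_id: "linear_on V V (\<lambda>x. x)"
  unfolding linear_on_def by simp

lemma
  assumes "csubspace V"
  shows csubspace_0: "0 \<in> V"
    and csubspace_add: "x \<in> V \<Longrightarrow> y \<in> V \<Longrightarrow> x + y \<in> V"
    and csubspace_scale: "x \<in> V \<Longrightarrow> c *\<^sub>C x \<in> V"
  using assms complex_vector.subspace_0 complex_vector.subspace_add complex_vector.subspace_scale by blast+

lemma csubspace_diff: "csubspace V \<Longrightarrow> x \<in> V \<Longrightarrow> y \<in> V \<Longrightarrow> x - y \<in> V"
  by (rule complex_vector.subspace_diff)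

lemma csubspaceI:
  assumes "0 \<in> V" "\<And>x y. x \<in> V \<Longrightarrow> y \<in> V \<Longrightarrow> x + y \<in> V" "\<And>c x. x \<in> V \<Longrightarrow> c *\<^sub>C x \<in> V"
  shows "csubspace V"
  using assms by (rule complex_vector.subspaceI)

lemma csubspace_UNIV [simp]: "csubspace UNIV"
  and csubspace_singleton_0 [simp]: "csubspace {0}"
  by (auto intro!: csubspaceI)

lemma csubspace_sum: "csubspace V \<Longrightarrow> (\<And>i. i \<in> I \<Longrightarrow> x i \<in> V) \<Longrightarrow> sum x I \<in> V"
  by (rule complex_vector.subspace_sum)

lemma linear_on_0:
  assumes "csubspace V" "linear_on V W f"
  shows "f 0 = 0"
  using linear_on_scale[OF assms(2) csubspace_0[OF assms(1)], of 0] by simp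

lemma linear_on_diff:
  assumes V: "csubspace V" and f: "linear_on V W f" and x: "x \<in> V" and y: "y \<in> V"
  shows "f (x - y) = f x - f y"
  using linear_on_add[OF f csubspace_diff[OF V x y] y] by simp

lemma linear_on_sum:
  assumes V: "csubspace V" and f: "linear_on V W f"
  shows "(\<And>i. i \<in> I \<Longrightarrow> x i \<in> V) \<Longrightarrow> f (\<Sum>i\<in>I. x i) = (\<Sum>i\<in>I. f (x i))"
proof (induction I rule: infinite_finite_induct)
  case (insert i I)
  then show ?case using csubspace_sum[OF V, of I x] linear_on_add[OF f] by simp
qed (simp_all add: linear_on_0[OF V f])

lemma linear_on_cong:
  assumes V: "csubspace V" and f: "linear_on V W f" and eq: "\<And>x. x \<in> V \<Longrightarrow> f x = f' x"
  shows "linear_on V W f'"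
  by (rule linear_onI)
    (simp_all add: eq[symmetric] linear_on_mem[OF f] linear_on_add[OF f] linear_on_scale[OF f]
      csubspace_add[OF V] csubspace_scale[OF V])

lemma linear_on_inv_into:
  assumes V: "csubspace V" and f: "linear_on V W f" and b: "bij_betw f V W"
  shows "linear_on W V (inv_into V f)"
proof (rule linear_onI)
  have inj: "inj_on f V" and W: "f ` V = W" using b by (auto simp: bij_betw_def)
  show "inv_into V f x \<in> V" if "x \<in> W" for x using that W by (simp add: inv_into_into)
  note mem = this
  have r: "f (inv_into V f x) = x" if "x \<in> W" for x using that W by (simp add: f_inv_into_f)
  show "inv_into V f (x + y) = inv_into V f x + inv_into V f y" if "x \<in> W" "y \<in> W" for x y
    by (rule inv_into_f_eq[OF inj])
      (use that mem csubspace_add[OF V] linear_on_add[OF f] r in auto)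
  show "inv_into V f (c *\<^sub>C x) = c *\<^sub>C inv_into V f x" if "x \<in> W" for c x
    by (rule inv_into_f_eq[OF inj])
      (use that mem csubspace_scale[OF V] linear_on_scale[OF f] r in auto)
qed

section \<open>Functionals, frames and the trace\<close>

lemma linear_functional_exists:
  fixes v :: "'a::complex_vector"
  assumes "v \<noteq> 0"
  shows "\<exists>d :: 'a \<Rightarrow> complex. linear_on UNIV UNIV d \<and> d v = 1"
proof -
  interpret cp: vector_space_pair "scaleC :: complex \<Rightarrow> 'a \<Rightarrow> 'a" "scaleC :: complex \<Rightarrow> complex \<Rightarrow> complex" ..
  have "\<not> cdependent {v}" using assms by simp
  from cp.linear_independent_extend[OF this[unfolded cdependent_def], of "\<lambda>_. 1"]
  obtain d where d: "Vector_Spaces.linear (*\<^sub>C) (*\<^sub>C) d" "d v = (1::complex)" by auto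
  interpret l: Vector_Spaces.linear "(*\<^sub>C)" "(*\<^sub>C)" d by fact
  show ?thesis by (intro exI[of _ d]) (simp add: linear_on_def l.add l.scale d)
qed

text \<open>
  Finitely many vectors and functionals with \<open>x = \<Sum>i. d\<^sub>i(x) e\<^sub>i\<close> compute the trace, although the \<open>e\<^sub>i\<close>
  need not be linearly independent: some of them may vanish.
\<close>
lemma linear_trace_frame:
  fixes V :: "'a::complex_vector set" and e :: "'i \<Rightarrow> 'a"
  assumes V: "csubspace V" and f: "linear_on V V f" and I: "finite I"
    and e: "\<And>i. i \<in> I \<Longrightarrow> e i \<in> V" and d: "\<And>i. i \<in> I \<Longrightarrow> linear_on V UNIV (d i)"
    and frame: "\<And>x. x \<in> V \<Longrightarrow> x = (\<Sum>i\<in>I. d i x *\<^sub>C e i)"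
  shows "linear_trace V f = (\<Sum>i\<in>I. d i (f (e i)))"
proof -
  define B where "B = (SOME B. \<not> cdependent B \<and> cspan B = V)"
  have "\<exists>B. \<not> cdependent B \<and> cspan B = V"
    using complex_vector.basis_exists[of V] complex_vector.span_subspace[OF _ _ V] by metis
  then have B: "\<not> cdependent B" "cspan B = V"
    unfolding B_def by (metis (mono_tags, lifting) someI_ex)+
  have "V \<subseteq> cspan (e ` I)"
  proof
    fix x assume "x \<in> V"
    then have x: "x = (\<Sum>i\<in>I. d i x *\<^sub>C e i)" by (rule frame)
    show "x \<in> cspan (e ` I)"
      by (subst x, intro complex_vector.span_sum complex_vector.span_scale complex_vector.span_base) auto
  qed
  \<comment> \<open>The basis picked by the choice operator is independent inside the span of a
    finite set. Its finiteness makes the sum in \<open>linear_trace\<close> a genuine one.\<close>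
  then have "finite B"
    using complex_vector.independent_span_bound[of "e ` I" B] B I complex_vector.span_superset[of B] by auto
  have BV: "b \<in> V" if "b \<in> B" for b using that B complex_vector.span_base by blast
  have fV: "f (e i) \<in> V" if "i \<in> I" for i using that e linear_on_mem[OF f] by blast
  have fb: "f b = (\<Sum>i\<in>I. d i b *\<^sub>C f (e i))" if "b \<in> B" for b
    by (subst frame[OF BV[OF that]])
      (use e csubspace_scale[OF V] linear_on_scale[OF f] in \<open>simp add: linear_on_sum[OF V f]\<close>)
  have rep: "crepresentation B (f b) b = (\<Sum>i\<in>I. d i b * crepresentation B (f (e i)) b)" if "b \<in> B" for b
  proof -
    have "crepresentation B (f b) = (\<lambda>b'. \<Sum>i\<in>I. crepresentation B (d i b *\<^sub>C f (e i)) b')"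
      unfolding fb[OF that] by (rule complex_vector.representation_sum[OF B(1)])
        (use fV B csubspace_scale[OF V] in auto)
    then show ?thesis
      by (simp add: complex_vector.representation_scale[OF B(1)] fV B)
  qed
  \<comment> \<open>The frame writes f as the sum of the rank one maps x \<mapsto> d_i(x) f(e_i).
    Swapping the sums leaves the trace of each of them, which is d_i(f(e_i)).\<close>
  have "linear_trace V f = (\<Sum>b\<in>B. \<Sum>i\<in>I. d i b * crepresentation B (f (e i)) b)"
    unfolding linear_trace_def Let_def B_def[symmetric] by (intro sum.cong refl rep)
  also have "\<dots> = (\<Sum>i\<in>I. \<Sum>b\<in>B. crepresentation B (f (e i)) b * d i b)"
    by (subst sum.swap) (simp add: mult.commute)
  also have "\<dots> = (\<Sum>i\<in>I. d i (f (e i)))"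
  proof (rule sum.cong[OF refl])
    fix i assume i: "i \<in> I"
    have "f (e i) = (\<Sum>b\<in>B. crepresentation B (f (e i)) b *\<^sub>C b)"
      using complex_vector.sum_representation_eq[OF B(1) _ \<open>finite B\<close> subset_refl, of "f (e i)"] fV[OF i] B by simp
    then have "d i (f (e i)) = d i (\<Sum>b\<in>B. crepresentation B (f (e i)) b *\<^sub>C b)" by simp
    also have "\<dots> = (\<Sum>b\<in>B. crepresentation B (f (e i)) b * d i b)"
      using BV csubspace_scale[OF V] linear_on_scale[OF d[OF i]]
      by (simp add: linear_on_sum[OF V d[OF i]] scaleC_complex_def)
    finally show "(\<Sum>b\<in>B. crepresentation B (f (e i)) b * d i b) = d i (f (e i))" by simp
  qed
  finally show ?thesis .
qed


section \<open>Tensor products\<close>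

lemma tensor_add_left: "(v + v') \<otimes>\<^sub>v w = v \<otimes>\<^sub>v w + v' \<otimes>\<^sub>v w"
  \<comment> \<open>The difference arises in the form x - (y + z), and \<open>diff_diff_eq\<close>
    gives it the form x - y - z of the relations.\<close>
  by transfer (unfold tensor_rel_def diff_diff_eq[symmetric] bilinear_relations_def,
      rule complex_vector.span_base, blast)

lemma tensor_add_right: "v \<otimes>\<^sub>v (w + w') = v \<otimes>\<^sub>v w + v \<otimes>\<^sub>v w'"
  by transfer (unfold tensor_rel_def diff_diff_eq[symmetric] bilinear_relations_def,
      rule complex_vector.span_base, blast)

lemma tensor_scale_left: "(c *\<^sub>C v) \<otimes>\<^sub>v w = c *\<^sub>C (v \<otimes>\<^sub>v w)"
  by transfer (unfold tensor_rel_def bilinear_relations_def, rule complex_vector.span_base, blast)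

lemma tensor_scale_right: "v \<otimes>\<^sub>v (c *\<^sub>C w) = c *\<^sub>C (v \<otimes>\<^sub>v w)"
  by transfer (unfold tensor_rel_def bilinear_relations_def, rule complex_vector.span_base, blast)

lemmas tensor_bilinear = tensor_add_left tensor_add_right tensor_scale_left tensor_scale_right

lemma tensor_0_left [simp]: "0 \<otimes>\<^sub>v w = 0" and tensor_0_right [simp]: "v \<otimes>\<^sub>v 0 = 0"
  using tensor_scale_left[of 0 0 w] tensor_scale_right[of v 0 0] by simp_all

lemma tensor_sum_left: "(\<Sum>i\<in>I. v i) \<otimes>\<^sub>v w = (\<Sum>i\<in>I. v i \<otimes>\<^sub>v w)"
  by (induction I rule: infinite_finite_induct) (simp_all add: tensor_add_left)

lemma tensor_sum_right: "v \<otimes>\<^sub>v (\<Sum>i\<in>I. w i) = (\<Sum>i\<in>I. v \<otimes>\<^sub>v w i)"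
  by (induction I rule: infinite_finite_induct) (simp_all add: tensor_add_right)

section \<open>Tensor products of subspaces and induction over elementary tensors\<close>

lemma csubspace_tensor_space [simp]: "csubspace (tensor_space V W)"
  unfolding tensor_space_def by (rule complex_vector.subspace_span)

lemma tensor_in_space [intro]: "v \<in> V \<Longrightarrow> w \<in> W \<Longrightarrow> v \<otimes>\<^sub>v w \<in> tensor_space V W"
  unfolding tensor_space_def by (rule complex_vector.span_base) blast

text \<open>No case for scalar multiples arises: the coefficient of an elementary tensor is absorbed
  into its left factor, since V is closed under scaling.\<close>

lemma tensor_space_induct [consumes 3, case_names tensor add]:
  assumes x: "x \<in> tensor_space V W" and V: "csubspace V" and W: "csubspace W"
    and tensor: "\<And>v w. v \<in> V \<Longrightarrow> w \<in> W \<Longrightarrow> P (v \<otimes>\<^sub>v w)"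
    and add: "\<And>x y. x \<in> tensor_space V W \<Longrightarrow> y \<in> tensor_space V W \<Longrightarrow> P x \<Longrightarrow> P y \<Longrightarrow> P (x + y)"
  shows "P x"
proof -
  have "x \<in> tensor_space V W \<and> P x"
    using x unfolding tensor_space_def
  proof (induction rule: complex_vector.span_induct_alt)
    case base
    show ?case using tensor[OF csubspace_0[OF V] csubspace_0[OF W]] by (simp add: complex_vector.span_zero)
  next
    case (step c x y)
    then obtain v w where x: "x = v \<otimes>\<^sub>v w" "v \<in> V" "w \<in> W" by blast
    have cv: "c *\<^sub>C v \<in> V" using x(2) csubspace_scale[OF V] by blast
    then have m: "c *\<^sub>C x \<in> tensor_space V W" and p: "P (c *\<^sub>C x)"
      using tensor[OF cv x(3)] tensor_in_space[OF cv x(3)] by (simp_all add: x tensor_scale_left)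
    show ?case
      using add[OF m _ p] csubspace_add[OF csubspace_tensor_space m] step
      by (simp add: tensor_space_def)
  qed
  then show ?thesis ..
qed

text \<open>A formal combination has finite support and is built up one generator at a time. This
  makes \<open>tensor_space_induct\<close> available for arbitrary elements of the type, as is
  needed for maps lifted from \<open>UNIV\<close>.\<close>

lemma tensor_space_UNIV [simp]: "tensor_space UNIV UNIV = (UNIV :: ('a::complex_vector, 'b::complex_vector) tensor set)"
proof -
  have "abs_tensor r \<in> tensor_space UNIV UNIV" for r :: "('a \<times> 'b) \<Rightarrow>\<^sub>0 complex"
  proof (induction r rule: Poly_Mapping.update_induct)
    case const
    show ?case using csubspace_0[OF csubspace_tensor_space] by (simp flip: zero_tensor_def)
  next
    case (update r k c)
    obtain v w where k: "k = (v, w)" by (cases k)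
    have "Poly_Mapping.update k c r = r + c *\<^sub>C free_gen v w"
      by (rule poly_mapping_eqI)
        (use update k in \<open>auto simp: lookup_update lookup_add lookup_single scaleC_poly_mapping.rep_eq
          scaleC_complex_def in_keys_iff when_def\<close>)
    then have "abs_tensor (Poly_Mapping.update k c r) = abs_tensor r + c *\<^sub>C (v \<otimes>\<^sub>v w)"
      by (simp add: scaleC_tensor.abs_eq tensor_of.abs_eq plus_tensor.abs_eq)
    then show ?case
      using update by (auto intro!: csubspace_add[OF csubspace_tensor_space] csubspace_scale[OF csubspace_tensor_space])
  qed
  then have "x \<in> tensor_space UNIV UNIV" for x :: "('a, 'b) tensor"
    by (induct x rule: tensor.abs_induct)
  then show ?thesis by auto
qed

lemma tensor_space_0_left [simp]: "tensor_space {0} W = {0}"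
  and tensor_space_0_right [simp]: "tensor_space V {0} = {0}"
proof -
  have "tensor_space {0} W \<subseteq> cspan {0}" and "tensor_space V {0} \<subseteq> cspan {0}"
    unfolding tensor_space_def by (rule complex_vector.span_mono, force)+
  then show "tensor_space {0} W = {0}" "tensor_space V {0} = {0}"
    using csubspace_0[OF csubspace_tensor_space, of "{0}" W] csubspace_0[OF csubspace_tensor_space, of V "{0}"]
    by (simp_all add: subset_singleton_iff) blast+
qed

lemma tensor_ext:
  assumes x: "x \<in> tensor_space V W" and "csubspace V" "csubspace W"
    and f: "linear_on (tensor_space V W) X f" and g: "linear_on (tensor_space V W) Y g"
    and eq: "\<And>v w. v \<in> V \<Longrightarrow> w \<in> W \<Longrightarrow> f (v \<otimes>\<^sub>v w) = g (v \<otimes>\<^sub>v w)"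
  shows "f x = g x"
  using x assms(2,3)
  by (induction x rule: tensor_space_induct) (simp_all add: eq linear_on_add[OF f] linear_on_add[OF g])

section \<open>Maps out of a tensor product\<close>

definition bilinear_on ::
    "'a::complex_vector set \<Rightarrow> 'b::complex_vector set \<Rightarrow> ('a \<Rightarrow> 'b \<Rightarrow> 'c::complex_vector) \<Rightarrow> bool" where
  "bilinear_on V W \<beta> \<longleftrightarrow>
     (\<forall>w\<in>W. linear_on V UNIV (\<lambda>v. \<beta> v w)) \<and> (\<forall>v\<in>V. linear_on W UNIV (\<beta> v))"

lemma tensor_lift_spec:
  assumes "csubspace V" "csubspace W" "bilinear_on V W \<beta>"
  shows "linear_on (tensor_space V W) UNIV (tensor_lift V W \<beta>)
    \<and> (\<forall>v\<in>V. \<forall>w\<in>W. tensor_lift V W \<beta> (v \<otimes>\<^sub>v w) = \<beta> v w)"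
  unfolding tensor_lift_def
  by (rule someI_ex[OF tensor_lift_exists[OF assms(1,2)]])
    (use assms(3) in \<open>auto simp: bilinear_on_def\<close>)

lemma tensor_lift_tensor:
  "csubspace V \<Longrightarrow> csubspace W \<Longrightarrow> bilinear_on V W \<beta> \<Longrightarrow> v \<in> V \<Longrightarrow> w \<in> W
    \<Longrightarrow> tensor_lift V W \<beta> (v \<otimes>\<^sub>v w) = \<beta> v w"
  using tensor_lift_spec by blast

lemma linear_tensor_lift:
  assumes V: "csubspace V" and W: "csubspace W" and \<beta>: "bilinear_on V W \<beta>"
    and X: "csubspace X" and mem: "\<And>v w. v \<in> V \<Longrightarrow> w \<in> W \<Longrightarrow> \<beta> v w \<in> X"
  shows "linear_on (tensor_space V W) X (tensor_lift V W \<beta>)"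
proof -
  have l: "linear_on (tensor_space V W) UNIV (tensor_lift V W \<beta>)"
    using tensor_lift_spec[OF V W \<beta>] by blast
  have "tensor_lift V W \<beta> x \<in> X" if "x \<in> tensor_space V W" for x
    using that V W
  proof (induction x rule: tensor_space_induct)
    case (tensor v w)
    then show ?case using mem by (simp add: tensor_lift_tensor[OF V W \<beta>])
  next
    case (add x y)
    then show ?case using csubspace_add[OF X] by (simp add: linear_on_add[OF l])
  qed
  then show ?thesis using l unfolding linear_on_def by blast
qed

lemma bilinear_tensor_map:
  assumes "linear_on V V' f" "linear_on W W' g"
  shows "bilinear_on V W (\<lambda>v w. f v \<otimes>\<^sub>v g w)"
  using assms unfolding bilinear_on_def linear_on_def by (simp add: tensor_bilinear)

lemma tensor_map_tensor:
  assumes "csubspace V" "csubspace W" "linear_on V V' f" "linear_on W W' g" "v \<in> V" "w \<in> W"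
  shows "tensor_map V W f g (v \<otimes>\<^sub>v w) = f v \<otimes>\<^sub>v g w"
  unfolding tensor_map_def
  using assms(5,6) by (rule tensor_lift_tensor[OF assms(1,2) bilinear_tensor_map[OF assms(3,4)]])

lemma linear_tensor_map:
  assumes "csubspace V" "csubspace W" "linear_on V V' f" "linear_on W W' g"
  shows "linear_on (tensor_space V W) (tensor_space V' W') (tensor_map V W f g)"
  unfolding tensor_map_def
  by (rule linear_tensor_lift[OF assms(1,2) bilinear_tensor_map[OF assms(3,4)]])
    (auto intro: linear_on_mem[OF assms(3)] linear_on_mem[OF assms(4)])

lemma tensor_map_compose:
  assumes V: "csubspace V" "csubspace V'" and W: "csubspace W" "csubspace W'"
    and f: "linear_on V V' f" and f': "linear_on V' V'' f'"
    and g: "linear_on W W' g" and g': "linear_on W' W'' g'"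
    and x: "x \<in> tensor_space V W"
  shows "tensor_map V' W' f' g' (tensor_map V W f g x) = tensor_map V W (\<lambda>v. f' (f v)) (\<lambda>w. g' (g w)) x"
proof (rule tensor_ext[OF x V(1) W(1)])
  show "linear_on (tensor_space V W) (tensor_space V'' W'') (\<lambda>x. tensor_map V' W' f' g' (tensor_map V W f g x))"
    by (rule linear_on_compose[OF linear_tensor_map linear_tensor_map]) fact+
  show "linear_on (tensor_space V W) (tensor_space V'' W'') (tensor_map V W (\<lambda>v. f' (f v)) (\<lambda>w. g' (g w)))"
    by (rule linear_tensor_map[OF V(1) W(1) linear_on_compose[OF f f'] linear_on_compose[OF g g']])
  fix v w assume v: "v \<in> V" and w: "w \<in> W"
  show "tensor_map V' W' f' g' (tensor_map V W f g (v \<otimes>\<^sub>v w)) = tensor_map V W (\<lambda>v. f' (f v)) (\<lambda>w. g' (g w)) (v \<otimes>\<^sub>v w)"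
    by (simp add: tensor_map_tensor[OF V(1) W(1) f g v w]
        tensor_map_tensor[OF V(2) W(2) f' g' linear_on_mem[OF f v] linear_on_mem[OF g w]]
        tensor_map_tensor[OF V(1) W(1) linear_on_compose[OF f f'] linear_on_compose[OF g g'] v w])
qed

lemma tensor_map_cong:
  assumes V: "csubspace V" "csubspace W" and f: "linear_on V V' f" and g: "linear_on W W' g"
    and f': "\<And>v. v \<in> V \<Longrightarrow> f v = f' v" and g': "\<And>w. w \<in> W \<Longrightarrow> g w = g' w"
    and x: "x \<in> tensor_space V W"
  shows "tensor_map V W f g x = tensor_map V W f' g' x"
proof -
  have lf: "linear_on V V' f'" and lg: "linear_on W W' g'"
    using linear_on_cong[OF V(1) f f'] linear_on_cong[OF V(2) g g'] by auto
  show ?thesis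
    by (rule tensor_ext[OF x V linear_tensor_map[OF V f g] linear_tensor_map[OF V lf lg]])
      (simp add: tensor_map_tensor[OF V f g] tensor_map_tensor[OF V lf lg] f' g')
qed

lemma tensor_map_id:
  assumes V: "csubspace V" "csubspace W" and x: "x \<in> tensor_space V W"
  shows "tensor_map V W (\<lambda>v. v) (\<lambda>w. w) x = x"
  by (rule tensor_ext[OF x V linear_tensor_map[OF V linear_on_id linear_on_id] linear_on_id])
    (simp add: tensor_map_tensor[OF V linear_on_id linear_on_id])

text \<open>The inverse is induced by the inverses of f and g, which are linear by
  \<open>linear_on_inv_into\<close>; both composites collapse by
  \<open>tensor_map_compose\<close>.\<close>

lemma bij_betw_tensor_map:
  assumes V: "csubspace V" "csubspace V'" and W: "csubspace W" "csubspace W'"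
    and f: "linear_on V V' f" "bij_betw f V V'" and g: "linear_on W W' g" "bij_betw g W W'"
  shows "bij_betw (tensor_map V W f g) (tensor_space V W) (tensor_space V' W')"
proof -
  let ?f = "inv_into V f" and ?g = "inv_into W g"
  have f': "linear_on V' V ?f" and g': "linear_on W' W ?g"
    using linear_on_inv_into V(1) W(1) f g by blast+
  have l: "tensor_map V' W' ?f ?g (tensor_map V W f g x) = x" if x: "x \<in> tensor_space V W" for x
  proof -
    have "tensor_map V W (\<lambda>v. ?f (f v)) (\<lambda>w. ?g (g w)) x = tensor_map V W (\<lambda>v. v) (\<lambda>w. w) x"
      by (rule tensor_map_cong[OF V(1) W(1) linear_on_compose[OF f(1) f'] linear_on_compose[OF g(1) g'] _ _ x])
        (use f g in \<open>auto simp: bij_betw_inv_into_left\<close>)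
    then show ?thesis
      by (simp add: tensor_map_compose[OF V W f(1) f' g(1) g' x] tensor_map_id[OF V(1) W(1) x])
  qed
  have r: "tensor_map V W f g (tensor_map V' W' ?f ?g x) = x" if x: "x \<in> tensor_space V' W'" for x
  proof -
    have "tensor_map V' W' (\<lambda>v. f (?f v)) (\<lambda>w. g (?g w)) x = tensor_map V' W' (\<lambda>v. v) (\<lambda>w. w) x"
      by (rule tensor_map_cong[OF V(2) W(2) linear_on_compose[OF f' f(1)] linear_on_compose[OF g' g(1)] _ _ x])
        (use f g in \<open>auto simp: bij_betw_inv_into_right\<close>)
    then show ?thesis
      by (simp add: tensor_map_compose[OF V(2,1) W(2,1) f' f(1) g' g(1) x] tensor_map_id[OF V(2) W(2) x])
  qed
  show ?thesis
    by (rule bij_betw_byWitness[where f' = "tensor_map V' W' ?f ?g"])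
      (use l r linear_on_mem[OF linear_tensor_map[OF V(1) W(1) f(1) g(1)]]
        linear_on_mem[OF linear_tensor_map[OF V(2) W(2) f' g']] in auto)
qed

text \<open>An element of the categorical trace enters \<open>psi\<close> through the right factor
  of a \<open>tensor_map\<close>. This lemma and the next two turn linearity in that factor into
  linearity of \<open>psi\<close>, and into the vanishing of the summands at which the element is
  0.\<close>

lemma tensor_map_add_right:
  assumes V: "csubspace V" and W: "csubspace W" and f: "linear_on V V' f"
    and g: "linear_on W W' g" and g': "linear_on W W' g'" and x: "x \<in> tensor_space V W"
  shows "tensor_map V W f (\<lambda>w. g w + g' w) x = tensor_map V W f g x + tensor_map V W f g' x"
proof -
  have s: "linear_on W UNIV (\<lambda>w. g w + g' w)"
    by (rule linear_onI)
      (simp_all add: linear_on_add[OF g] linear_on_add[OF g'] linear_on_scale[OF g]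
        linear_on_scale[OF g'] scaleC_add_right)
  note lg = linear_tensor_map[OF V W f g] and lg' = linear_tensor_map[OF V W f g']
  show ?thesis
  proof (rule tensor_ext[OF x V W linear_tensor_map[OF V W f s], where Y = UNIV])
    show "linear_on (tensor_space V W) UNIV (\<lambda>x. tensor_map V W f g x + tensor_map V W f g' x)"
      by (rule linear_onI)
        (simp_all add: linear_on_add[OF lg] linear_on_add[OF lg'] linear_on_scale[OF lg]
          linear_on_scale[OF lg'] scaleC_add_right)
  qed (simp add: tensor_map_tensor[OF V W f s] tensor_map_tensor[OF V W f g]
      tensor_map_tensor[OF V W f g'] tensor_add_right)
qed

lemma tensor_map_scale_right:
  assumes V: "csubspace V" and W: "csubspace W" and f: "linear_on V V' f"
    and g: "linear_on W W' g" and x: "x \<in> tensor_space V W"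
  shows "tensor_map V W f (\<lambda>w. c *\<^sub>C g w) x = c *\<^sub>C tensor_map V W f g x"
proof -
  have s: "linear_on W UNIV (\<lambda>w. c *\<^sub>C g w)"
    by (rule linear_onI)
      (simp_all add: linear_on_add[OF g] linear_on_scale[OF g] scaleC_add_right scaleC_scaleC mult.commute)
  note lg = linear_tensor_map[OF V W f g]
  show ?thesis
  proof (rule tensor_ext[OF x V W linear_tensor_map[OF V W f s], where Y = UNIV])
    show "linear_on (tensor_space V W) UNIV (\<lambda>x. c *\<^sub>C tensor_map V W f g x)"
      by (rule linear_onI)
        (simp_all add: linear_on_add[OF lg] linear_on_scale[OF lg] scaleC_add_right scaleC_scaleC mult.commute)
  qed (simp add: tensor_map_tensor[OF V W f s] tensor_map_tensor[OF V W f g] tensor_scale_right)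
qed

lemma tensor_map_zero_right:
  assumes V: "csubspace V" and W: "csubspace W" and f: "linear_on V V' f" and x: "x \<in> tensor_space V W"
  shows "tensor_map V W f (\<lambda>w. 0) x = 0"
proof -
  have z: "linear_on W {0} (\<lambda>w. 0)" by (rule linear_onI) simp_all
  show ?thesis using linear_on_mem[OF linear_tensor_map[OF V W f z] x] by simp
qed

text \<open>Functionals with value 1 at v and at w would give a bilinear form whose lift takes the
  value 1 on the elementary tensor. The dimension bound for the entries uses this as injectivity of
  tensoring with a nonzero vector.\<close>

lemma tensor_eq_0D:
  assumes "v \<otimes>\<^sub>v w = 0"
  shows "v = 0 \<or> w = 0"
proof (rule ccontr)
  assume "\<not> (v = 0 \<or> w = 0)"
  then obtain d d' where d: "linear_on UNIV UNIV d" "d v = (1::complex)"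
    and d': "linear_on UNIV UNIV d'" "d' w = (1::complex)"
    using linear_functional_exists by metis
  have b: "bilinear_on UNIV UNIV (\<lambda>v w. d v * d' w)"
    using d(1) d'(1) by (simp add: bilinear_on_def linear_on_def scaleC_complex_def algebra_simps)
  have "tensor_lift UNIV UNIV (\<lambda>v w. d v * d' w) (v \<otimes>\<^sub>v w) = 1"
    using d d' by (simp add: tensor_lift_tensor[OF _ _ b])
  moreover have "tensor_lift UNIV UNIV (\<lambda>v w. d v * d' w) 0 = 0"
    by (rule linear_on_0[OF csubspace_tensor_space linear_tensor_lift[OF _ _ b csubspace_UNIV]]) auto
  ultimately show False using assms by simp
qed


section \<open>2-matrices\<close>

lemma is_mat2D: "is_mat2 n A \<Longrightarrow> i < n \<Longrightarrow> j < n \<Longrightarrow> csubspace (A i j)"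
  unfolding is_mat2_def by blast

lemma is_mor2D: "is_mor2 n A B \<sigma> \<Longrightarrow> i < n \<Longrightarrow> j < n \<Longrightarrow> linear_on (A i j) (B i j) (\<sigma> i j)"
  unfolding is_mor2_def by blast

lemma is_iso2D:
  assumes "is_iso2 n A B \<sigma>" "i < n" "j < n"
  shows "linear_on (A i j) (B i j) (\<sigma> i j)" "bij_betw (\<sigma> i j) (A i j) (B i j)"
  using assms unfolding is_iso2_def is_mor2_def by blast+

lemma is_mat2_one2 [simp]: "is_mat2 n one2"
  by (simp add: is_mat2_def one2_def)

lemma coord_inj_same [simp]: "coord_inj l x l = x"
  and coord_inj_other [simp]: "k \<noteq> l \<Longrightarrow> coord_inj l x k = 0"
  and coord_inj_0 [simp]: "coord_inj l 0 = 0"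
  by (auto simp: coord_inj_def zero_fun_def)

lemma linear_coord_inj: "linear_on UNIV UNIV (coord_inj l)"
  by (rule linear_onI) (auto simp: coord_inj_def fun_eq_iff plus_fun_def scaleC_fun_def)

lemma csubspace_comp2 [simp]: "csubspace (comp2 n A B i j)"
  by (rule csubspaceI)
    (auto simp: comp2_def zero_fun_def plus_fun_def scaleC_fun_def csubspace_0 csubspace_add csubspace_scale)

lemma is_mat2_comp2 [simp]: "is_mat2 n (comp2 m A B)"
  by (simp add: is_mat2_def)

lemma comp2_entry: "t \<in> comp2 n A B i j \<Longrightarrow> k < n \<Longrightarrow> t k \<in> tensor_space (A i k) (B k j)"
  and comp2_outside: "t \<in> comp2 n A B i j \<Longrightarrow> \<not> k < n \<Longrightarrow> t k = 0"
  by (auto simp: comp2_def)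

lemma coord_inj_in_comp2:
  "l < n \<Longrightarrow> x \<in> tensor_space (A i l) (B l j) \<Longrightarrow> coord_inj l x \<in> comp2 n A B i j"
  by (auto simp: comp2_def coord_inj_def csubspace_0)

lemma linear_coord_inj_comp2:
  "l < n \<Longrightarrow> linear_on (tensor_space (A i l) (B l j)) (comp2 n A B i j) (coord_inj l)"
  using linear_coord_inj coord_inj_in_comp2 unfolding linear_on_def by blast

lemma scaleC_fun_apply: "(c *\<^sub>C f) x = c *\<^sub>C f x"
  by (simp add: scaleC_fun_def)

lemma sum_fun_apply: "(\<Sum>i\<in>I. f i) x = (\<Sum>i\<in>I. f i x)"
  by (induction I rule: infinite_finite_induct) simp_all

lemma comp2_eq_sum: "t \<in> comp2 n A B i j \<Longrightarrow> t = (\<Sum>l<n. coord_inj l (t l))"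
  by (rule ext) (auto simp: sum_fun_apply coord_inj_def comp2_def)

lemma is_mor2_id2 [simp]: "is_mor2 n A A id2"
  by (simp add: is_mor2_def linear_on_def id2_def)

lemma is_mor2_vcomp: "is_mor2 n A B \<sigma> \<Longrightarrow> is_mor2 n B C \<tau> \<Longrightarrow> is_mor2 n A C (\<tau> \<bullet> \<sigma>)"
  by (simp add: is_mor2_def linear_on_def vcomp_def)

lemma is_iso2_vcomp:
  assumes "is_iso2 n A B \<sigma>" "is_iso2 n B C \<tau>"
  shows "is_iso2 n A C (\<tau> \<bullet> \<sigma>)"
proof -
  have "(\<tau> \<bullet> \<sigma>) i j = \<tau> i j \<circ> \<sigma> i j" for i j by (simp add: fun_eq_iff vcomp_def)
  then show ?thesis
    using assms is_mor2_vcomp[of n A B \<sigma> C \<tau>] unfolding is_iso2_def by (metis bij_betw_trans)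
qed

lemma is_mor2_inv2:
  assumes "is_mat2 n A" "is_iso2 n A B \<sigma>"
  shows "is_mor2 n B A (inv2 A \<sigma>)"
  using assms unfolding is_mor2_def inv2_def is_mat2_def
  by (auto intro: linear_on_inv_into dest: is_iso2D)

lemma inv2_eqI:
  assumes "is_iso2 n A B \<sigma>" "i < n" "j < n" "x \<in> A i j" "\<sigma> i j x = y"
  shows "inv2 A \<sigma> i j y = x"
  using is_iso2D(2)[OF assms(1-3)] assms(4,5) by (auto simp: inv2_def bij_betw_def inv_into_f_eq)

lemma inv2_right:
  assumes "is_iso2 n A B \<sigma>" "i < n" "j < n" "y \<in> B i j"
  shows "\<sigma> i j (inv2 A \<sigma> i j y) = y"
  using is_iso2D(2)[OF assms(1-3)] assms(4) by (auto simp: inv2_def bij_betw_inv_into_right)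

lemma is_mor2_hcomp:
  assumes A: "is_mat2 n A" and B: "is_mat2 n B" and \<sigma>: "is_mor2 n A C \<sigma>" and \<tau>: "is_mor2 n B D \<tau>"
  shows "is_mor2 n (comp2 n A B) (comp2 n C D) (hcomp n A B \<sigma> \<tau>)"
  unfolding is_mor2_def
proof (intro allI impI)
  fix i j assume i: "i < n" and j: "j < n"
  have l: "linear_on (tensor_space (A i k) (B k j)) (tensor_space (C i k) (D k j))
      (tensor_map (A i k) (B k j) (\<sigma> i k) (\<tau> k j))" if "k < n" for k
    using i j that by (intro linear_tensor_map is_mat2D[OF A] is_mat2D[OF B] is_mor2D[OF \<sigma>] is_mor2D[OF \<tau>])
  show "linear_on (comp2 n A B i j) (comp2 n C D i j) (hcomp n A B \<sigma> \<tau> i j)"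
  proof (rule linear_onI)
    fix t assume t: "t \<in> comp2 n A B i j"
    show "hcomp n A B \<sigma> \<tau> i j t \<in> comp2 n C D i j"
      using linear_on_mem[OF l comp2_entry[OF t]] by (auto simp: comp2_def hcomp_def)
    show "hcomp n A B \<sigma> \<tau> i j (c *\<^sub>C t) = c *\<^sub>C hcomp n A B \<sigma> \<tau> i j t" for c
      using linear_on_scale[OF l comp2_entry[OF t]] by (auto simp: hcomp_def fun_eq_iff scaleC_fun_def)
    fix s assume s: "s \<in> comp2 n A B i j"
    show "hcomp n A B \<sigma> \<tau> i j (t + s) = hcomp n A B \<sigma> \<tau> i j t + hcomp n A B \<sigma> \<tau> i j s"
      using linear_on_add[OF l comp2_entry[OF t] comp2_entry[OF s]]
      by (auto simp: hcomp_def fun_eq_iff)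
  qed
qed

text \<open>In row i only the coordinate i of an element of the composite can be nonzero, and there
  c \<otimes> x = 1 \<otimes> (c x). Hence placing 1 \<otimes> x at coordinate i inverts the
  unitor.\<close>

lemma is_iso2_left_unitor:
  assumes B: "is_mat2 n B"
  shows "is_iso2 n (comp2 n one2 B) B left_unitor"
proof -
  let ?m = "tensor_lift UNIV UNIV (\<lambda>c (x::'a). c *\<^sub>C x)"
  have b: "bilinear_on UNIV UNIV (\<lambda>c (x::'a). c *\<^sub>C x)"
    by (auto simp: bilinear_on_def linear_on_def scaleC_add_left scaleC_add_right scaleC_scaleC
        scaleC_complex_def mult.commute)
  have l: "linear_on UNIV UNIV ?m"
    using linear_tensor_lift[OF _ _ b, of UNIV] by simp
  have m: "?m (c \<otimes>\<^sub>v x) = c *\<^sub>C x" for c x by (simp add: tensor_lift_tensor[OF _ _ b])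
  have mem: "?m s \<in> V" and one: "1 \<otimes>\<^sub>v ?m s = s" if "s \<in> tensor_space UNIV V" "csubspace V" for s V
  proof -
    have "?m s \<in> V \<and> 1 \<otimes>\<^sub>v ?m s = s"
      using that(1) csubspace_UNIV that(2)
    proof (induction rule: tensor_space_induct)
      case (tensor c x)
      have "1 \<otimes>\<^sub>v (c *\<^sub>C x) = c \<otimes>\<^sub>v x"
        using tensor_scale_left[of c "1::complex" x] by (simp add: tensor_scale_right scaleC_complex_def)
      then show ?case using tensor csubspace_scale[OF that(2)] by (simp add: m)
    next
      case (add x y)
      then show ?case
        using csubspace_add[OF that(2)] by (simp add: linear_on_add[OF l] tensor_add_right)
    qed
    then show "?m s \<in> V" "1 \<otimes>\<^sub>v ?m s = s" by blast+
  qed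
  have iso: "linear_on (comp2 n one2 B i j) (B i j) (left_unitor i j)
      \<and> bij_betw (left_unitor i j) (comp2 n one2 B i j) (B i j)" if i: "i < n" and j: "j < n" for i j
  proof -
    have Bij: "csubspace (B i j)" using is_mat2D[OF B i j] .
    have ti: "t i \<in> tensor_space UNIV (B i j)" if "t \<in> comp2 n one2 B i j" for t
      using comp2_entry[OF that i] by (simp add: one2_def)
    have t: "t = coord_inj i (t i)" if "t \<in> comp2 n one2 B i j" for t
    proof
      fix k show "t k = coord_inj i (t i) k"
        using comp2_entry[OF that, of k] comp2_outside[OF that, of k]
        by (cases "k = i"; cases "k < n") (auto simp: one2_def)
    qed
    have "linear_on (comp2 n one2 B i j) (B i j) (left_unitor i j)"
      by (rule linear_onI)
        (simp_all add: left_unitor_def plus_fun_def scaleC_fun_def linear_on_add[OF l] linear_on_scale[OF l]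
          mem[OF ti Bij])
    moreover have "bij_betw (left_unitor i j) (comp2 n one2 B i j) (B i j)"
    proof (rule bij_betw_byWitness[where f' = "\<lambda>x. coord_inj i (1 \<otimes>\<^sub>v x)"])
      show "\<forall>a\<in>comp2 n one2 B i j. coord_inj i (1 \<otimes>\<^sub>v left_unitor i j a) = a"
        using t one[OF ti Bij] by (simp add: left_unitor_def)
      show "\<forall>a'\<in>B i j. left_unitor i j (coord_inj i (1 \<otimes>\<^sub>v a')) = a'"
        by (simp add: left_unitor_def m scaleC_one)
      show "left_unitor i j ` comp2 n one2 B i j \<subseteq> B i j"
        using mem[OF ti Bij] by (auto simp: left_unitor_def)
      show "(\<lambda>x. coord_inj i (1 \<otimes>\<^sub>v x)) ` B i j \<subseteq> comp2 n one2 B i j"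
        using i by (auto intro!: coord_inj_in_comp2 tensor_in_space simp: one2_def)
    qed
    ultimately show ?thesis ..
  qed
  then show ?thesis unfolding is_iso2_def is_mor2_def by blast
qed

lemma inv2_left_unitor:
  assumes B: "is_mat2 n B" and i: "i < n" and j: "j < n" and x: "x \<in> B i j"
  shows "inv2 (comp2 n one2 B) left_unitor i j x = coord_inj i (1 \<otimes>\<^sub>v x)"
proof (rule inv2_eqI[OF is_iso2_left_unitor[OF B] i j])
  show "coord_inj i (1 \<otimes>\<^sub>v x) \<in> comp2 n one2 B i j"
    using i x by (auto intro!: coord_inj_in_comp2 tensor_in_space simp: one2_def)
  have b: "bilinear_on UNIV UNIV (\<lambda>c (x::'a). c *\<^sub>C x)"
    by (auto simp: bilinear_on_def linear_on_def scaleC_add_left scaleC_add_right scaleC_scaleC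
        scaleC_complex_def mult.commute)
  show "left_unitor i j (coord_inj i (1 \<otimes>\<^sub>v x)) = x"
    by (simp add: left_unitor_def tensor_lift_tensor[OF _ _ b] scaleC_one)
qed


section \<open>Traces of 2-morphisms\<close>

lemma cat_trace_mor2: "\<sigma> \<in> cat_trace n F \<Longrightarrow> is_mor2 n one2 F \<sigma>"
  by (simp add: cat_trace_def hom2_def)

lemma cat_trace_entry: "\<sigma> \<in> cat_trace n F \<Longrightarrow> i < n \<Longrightarrow> \<sigma> i i 1 \<in> F i i"
  by (drule cat_trace_mor2, drule (2) is_mor2D, erule linear_on_mem) (simp add: one2_def)

lemma restrict2_in_cat_trace:
  assumes "is_mor2 n one2 F \<sigma>"
  shows "restrict2 n one2 \<sigma> \<in> cat_trace n F"
proof -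
  have "is_mor2 n one2 F (restrict2 n one2 \<sigma>)"
    unfolding is_mor2_def
  proof (intro allI impI)
    fix i j assume i: "i < n" and j: "j < n"
    show "linear_on (one2 i j) (F i j) (restrict2 n one2 \<sigma> i j)"
      by (rule linear_on_cong[OF is_mat2D[OF is_mat2_one2 i j] is_mor2D[OF assms i j]])
        (simp add: restrict2_def i j)
  qed
  then show ?thesis by (auto simp: cat_trace_def hom2_def restrict2_def fun_eq_iff)
qed

text \<open>A diagonal component starts from the complex numbers and is determined by its value at
  1; off the diagonal the source is 0, and everywhere else the normalisation by
  \<open>restrict2\<close> yields 0. This is the identification of the categorical trace with the
  direct sum of the diagonal entries.\<close>

lemma cat_trace_value:
  assumes \<sigma>: "\<sigma> \<in> cat_trace n F"
  shows "\<sigma> i j c = (if i < n \<and> i = j then c *\<^sub>C \<sigma> i i 1 else 0)"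
proof -
  have r: "\<sigma> i j c = restrict2 n one2 \<sigma> i j c" using \<sigma> by (simp add: cat_trace_def hom2_def)
  show ?thesis
  proof (cases "i < n \<and> j < n \<and> c \<in> one2 i j")
    case True
    then have l: "linear_on (one2 i j) (F i j) (\<sigma> i j)"
      using is_mor2D[OF cat_trace_mor2[OF \<sigma>]] by blast
    show ?thesis
    proof (cases "i = j")
      case eq: True
      then show ?thesis using True linear_on_scale[OF l, of 1 c] by (simp add: one2_def scaleC_complex_def)
    next
      case False
      then have "c = 0" and "one2 i j = {0}" using True by (simp_all add: one2_def)
      then show ?thesis using False linear_on_0[OF _ l] by simp
    qed
  next
    case False
    then show ?thesis using r by (auto simp: restrict2_def one2_def)
  qed
qed

lemma cat_trace_ext:
  assumes "\<sigma> \<in> cat_trace n F" "\<tau> \<in> cat_trace n F" "\<And>i. i < n \<Longrightarrow> \<sigma> i i 1 = \<tau> i i 1"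
  shows "\<sigma> = \<tau>"
proof (intro ext)
  fix i j c
  show "\<sigma> i j c = \<tau> i j c"
    using assms(3) by (simp add: cat_trace_value[OF assms(1), of i j c] cat_trace_value[OF assms(2), of i j c])
qed

lemma csubspace_cat_trace:
  assumes F: "is_mat2 n F"
  shows "csubspace (cat_trace n F)"
proof -
  have V: "csubspace (F i j)" if "i < n" "j < n" for i j using is_mat2D[OF F that] .
  have l: "\<sigma> \<in> cat_trace n F \<longleftrightarrow>
      (\<forall>i j. (i < n \<and> j < n \<longrightarrow> linear_on (one2 i j) (F i j) (\<sigma> i j))
        \<and> (\<forall>x. \<not> (i < n \<and> j < n \<and> x \<in> one2 i j) \<longrightarrow> \<sigma> i j x = 0))" for \<sigma>
    unfolding cat_trace_def hom2_def is_mor2_def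
    by (auto simp: fun_eq_iff restrict2_def)
  show ?thesis
    by (rule csubspaceI)
      (auto simp: l linear_on_def zero_fun_def plus_fun_def scaleC_fun_def V csubspace_0 csubspace_add
        csubspace_scale algebra_simps scaleC_add_right scaleC_scaleC)
qed

section \<open>A formula for the 2-character\<close>

text \<open>The formula for the 2-character consults the invertibility of the components, which
  direct sums and tensor products inherit by composing isomorphisms. So it can be instantiated at
  \<rho>, at \<rho>' and at both combinations.\<close>

locale two_rep_isos = group G for G (structure) +
  fixes \<rho> :: "('g, 'a::complex_vector) rep2"
  assumes mat2: "g \<in> carrier G \<Longrightarrow> is_mat2 (rdim \<rho>) (rmor \<rho> g)"
    and phi1_iso: "is_iso2 (rdim \<rho>) (rmor \<rho> \<one>) one2 (rphi1 \<rho>)"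
    and phi_iso: "\<lbrakk>g \<in> carrier G; h \<in> carrier G\<rbrakk>
      \<Longrightarrow> is_iso2 (rdim \<rho>) (comp2 (rdim \<rho>) (rmor \<rho> g) (rmor \<rho> h)) (rmor \<rho> (g \<otimes> h)) (rphi \<rho> g h)"

text \<open>Restricted to the summand of index i, \<phi> multiplies the diagonal lines at i,
  compatibly with the grading by group elements.\<close>

definition diag_mult ::
    "('g, 'a::complex_vector) rep2 \<Rightarrow> 'g \<Rightarrow> 'g \<Rightarrow> nat \<Rightarrow> 'a \<Rightarrow> 'a \<Rightarrow> 'a" where
  "diag_mult \<rho> g h i a b = rphi \<rho> g h i i (coord_inj i (a \<otimes>\<^sub>v b))"

text \<open>The image of the scalar c under the two rightmost factors of \<open>psi\<close>, with
  all its coordinates; the trace will only look at the coordinate i.\<close>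

definition counit_tensor ::
    "('g, 'm) monoid_scheme \<Rightarrow> ('g, 'a::complex_vector) rep2 \<Rightarrow> 'g \<Rightarrow> nat \<Rightarrow> complex \<Rightarrow> nat \<Rightarrow> ('a, 'a) tensor" where
  "counit_tensor G \<rho> g i c =
     inv2 (comp2 (rdim \<rho>) (rmor \<rho> g) (rmor \<rho> (inv\<^bsub>G\<^esub> g))) (rphi \<rho> g (inv\<^bsub>G\<^esub> g)) i i
       (inv2 (rmor \<rho> \<one>\<^bsub>G\<^esub>) (rphi1 \<rho>) i i c)"

text \<open>
  The component of \<open>\<psi>\<^sub>g(h)\<close> from the \<open>i\<close>-th summand of the categorical trace to itself, evaluated on \<open>x\<close>
  with \<open>s\<close> in place of the element of \<open>(\<rho>\<^sub>g)\<^sub>i\<^sub>i \<otimes> (\<rho>\<^sub>k)\<^sub>i\<^sub>i\<close>, \<open>k\<close> the inverse of \<open>g\<close>, that is obtained from the unit.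
\<close>
definition diag_psi ::
    "('g, 'm) monoid_scheme \<Rightarrow> ('g, 'a::complex_vector) rep2 \<Rightarrow> 'g \<Rightarrow> 'g \<Rightarrow> nat \<Rightarrow> 'a \<Rightarrow> ('a, 'a) tensor \<Rightarrow> 'a" where
  "diag_psi G \<rho> g h i x s =
     rphi \<rho> g (h \<otimes>\<^bsub>G\<^esub> inv\<^bsub>G\<^esub> g) i i (coord_inj i
       (tensor_map (rmor \<rho> g i i) (rmor \<rho> (inv\<^bsub>G\<^esub> g) i i) (\<lambda>a. a) (diag_mult \<rho> h (inv\<^bsub>G\<^esub> g) i x) s))"

lemma (in two_representation) two_rep_isos: "two_rep_isos G \<rho>"
  by unfold_locales (fact mat2 phi1_iso phi_iso)+

context two_rep_isos
begin

abbreviation "N \<equiv> rdim \<rho>"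
abbreviation "R \<equiv> rmor \<rho>"

lemma space: "g \<in> carrier G \<Longrightarrow> i < N \<Longrightarrow> j < N \<Longrightarrow> csubspace (R g i j)"
  using is_mat2D[OF mat2] .

lemma linear_phi:
  "g \<in> carrier G \<Longrightarrow> h \<in> carrier G \<Longrightarrow> i < N \<Longrightarrow> j < N
    \<Longrightarrow> linear_on (comp2 N (R g) (R h) i j) (R (g \<otimes> h) i j) (rphi \<rho> g h i j)"
  using is_iso2D(1)[OF phi_iso] .

lemma linear_phi_coord:
  assumes g: "g \<in> carrier G" and h: "h \<in> carrier G" and i: "i < N" and j: "j < N" and l: "l < N"
    and x: "x \<in> R g i l"
  shows "linear_on (R h l j) (R (g \<otimes> h) i j) (\<lambda>b. rphi \<rho> g h i j (coord_inj l (x \<otimes>\<^sub>v b)))"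
proof -
  have "linear_on (R h l j) (tensor_space (R g i l) (R h l j)) (\<lambda>b. x \<otimes>\<^sub>v b)"
    using x by (auto intro!: linear_onI simp: tensor_bilinear)
  from linear_on_compose[OF linear_on_compose[OF this linear_coord_inj_comp2[OF l, of "R g" i "R h" j]] linear_phi[OF g h i j]]
  show ?thesis .
qed

section \<open>Dimension of the entries\<close>

lemma comp_inverse_iso:
  assumes "g \<in> carrier G"
  shows "is_iso2 N (comp2 N (R g) (R (inv g))) one2 (rphi1 \<rho> \<bullet> rphi \<rho> g (inv g))"
  using is_iso2_vcomp[OF _ phi1_iso] phi_iso[of g "inv g"] assms by simp

text \<open>The form covers lines and zero spaces alike. The functional lives on the ambient space,
  so that products of two such functionals lift to the full tensor type.\<close>

lemma entry_one_dim:
  assumes g: "g \<in> carrier G" and i: "i < N" and j: "j < N"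
  shows "\<exists>e\<in>R g i j. \<exists>d :: 'a \<Rightarrow> complex. linear_on UNIV UNIV d \<and> (\<forall>x\<in>R g i j. x = d x *\<^sub>C e)"
proof (cases "R g i j \<subseteq> {0}")
  case True
  then have "\<forall>x\<in>R g i j. x = (0::complex) *\<^sub>C (0::'a)" by auto
  moreover have "linear_on UNIV UNIV (\<lambda>_::'a. 0::complex)" by (auto simp: linear_on_def)
  ultimately show ?thesis using csubspace_0[OF space[OF g i j]] by (intro bexI exI) auto
next
  case False
  then obtain x where x: "x \<in> R g i j" "x \<noteq> 0" by blast
  have k: "inv g \<in> carrier G" using g by simp
  note iso = is_iso2D[OF comp_inverse_iso[OF g]]
  note iso' = is_iso2D[OF comp_inverse_iso[OF k]]
  \<comment> \<open>If row j of \<open>R (inv g)\<close> vanished, so would the (j, j) entry of its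
    composite with \<open>R (inv (inv g))\<close>. That entry is in bijection with the complex
    numbers, which have two distinct elements 0 and 1.\<close>
  have "\<exists>l<N. \<exists>b\<in>R (inv g) j l. b \<noteq> 0"
  proof (rule ccontr)
    assume *: "\<not> ?thesis"
    have "t = 0" if t: "t \<in> comp2 N (R (inv g)) (R (inv (inv g))) j j" for t
    proof
      fix l
      show "t l = 0 l"
      proof (cases "l < N")
        case True
        then have "R (inv g) j l = {0}" using * csubspace_0[OF space[OF k j True]] by blast
        then show ?thesis using comp2_entry[OF t True] by simp
      qed (simp add: comp2_outside[OF t])
    qed
    then have "comp2 N (R (inv g)) (R (inv (inv g))) j j \<subseteq> {0}" by blast
    moreover have "(rphi1 \<rho> \<bullet> rphi \<rho> (inv g) (inv (inv g))) j j ` comp2 N (R (inv g)) (R (inv (inv g))) j j = UNIV"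
      using bij_betw_imp_surj_on[OF iso'(2)[OF j j]] by (simp add: one2_def)
    ultimately have "(UNIV :: complex set) \<subseteq> {(rphi1 \<rho> \<bullet> rphi \<rho> (inv g) (inv (inv g))) j j 0}"
      by blast
    then have "{0, 1 :: complex} \<subseteq> {(rphi1 \<rho> \<bullet> rphi \<rho> (inv g) (inv (inv g))) j j 0}"
      by blast
    then show False by auto
  qed
  then obtain l b where l: "l < N" and b: "b \<in> R (inv g) j l" "b \<noteq> 0" by blast
  \<comment> \<open>The map y \<mapsto> \<open>?f (?t y)\<close> is linear with complex values, and
    it is injective: placing at a coordinate is injective, and so is tensoring with b.\<close>
  let ?C = "comp2 N (R g) (R (inv g)) i l" and ?f = "(rphi1 \<rho> \<bullet> rphi \<rho> g (inv g)) i l"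
  let ?t = "\<lambda>y. coord_inj j (y \<otimes>\<^sub>v b)"
  have t: "?t y \<in> ?C" if "y \<in> R g i j" for y
    using that b j by (intro coord_inj_in_comp2 tensor_in_space)
  have inj: "inj_on ?f ?C" using iso(2)[OF i l] by (simp add: bij_betw_def)
  have inj0: "y = 0" if y: "y \<in> R g i j" and z: "?f (?t y) = 0" for y
  proof -
    have "?f (?t y) = ?f 0" using z linear_on_0[OF _ iso(1)[OF i l]] by simp
    then have "?t y = 0" using inj_onD[OF inj _ t[OF y] csubspace_0] by simp
    then have "y \<otimes>\<^sub>v b = 0" by (metis coord_inj_same zero_fun_apply)
    then show "y = 0" using tensor_eq_0D b by blast
  qed
  have fx: "?f (?t x) \<noteq> 0" using inj0[OF x(1)] x(2) by blast
  have lin: "linear_on (R g i j) UNIV (\<lambda>y. ?f (?t y))"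
  proof -
    have "linear_on (R g i j) (tensor_space (R g i j) (R (inv g) j l)) (\<lambda>y. y \<otimes>\<^sub>v b)"
      using b by (auto intro!: linear_onI simp: tensor_bilinear)
    from linear_on_compose[OF linear_on_compose[OF this linear_coord_inj_comp2[OF j, of "R g" i "R (inv g)" l]] iso(1)[OF i l]]
    show ?thesis by (rule linear_on_mono) auto
  qed
  have multiple: "\<exists>c. y = c *\<^sub>C x" if y: "y \<in> R g i j" for y
  proof -
    \<comment> \<open>The scalar is forced: with the ratio of the two complex values, y - c x is
      sent to 0 by an injective map.\<close>
    define c where "c = ?f (?t y) / ?f (?t x)"
    have cx: "c *\<^sub>C x \<in> R g i j" using csubspace_scale[OF space[OF g i j] x(1)] .
    have "?f (?t (y - c *\<^sub>C x)) = 0"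
      using linear_on_diff[OF space[OF g i j] lin y cx] linear_on_scale[OF lin x(1), of c] fx
      by (simp add: scaleC_complex_def c_def)
    then show ?thesis using inj0[OF csubspace_diff[OF space[OF g i j] y cx]] by auto
  qed
  obtain d :: "'a \<Rightarrow> complex" where d: "linear_on UNIV UNIV d" "d x = 1"
    using linear_functional_exists[OF x(2)] by blast
  have "y = d y *\<^sub>C x" if "y \<in> R g i j" for y
    using multiple[OF that] d linear_on_scale[OF d(1)] by (auto simp: scaleC_complex_def)
  then show ?thesis using x(1) d(1) by blast
qed

lemma diag_frame_exists:
  assumes h: "h \<in> carrier G"
  shows "\<exists>(e :: nat \<Rightarrow> 'a) (d :: nat \<Rightarrow> 'a \<Rightarrow> complex). \<forall>i<N.
    e i \<in> R h i i \<and> linear_on UNIV UNIV (d i) \<and> (\<forall>x\<in>R h i i. x = d i x *\<^sub>C e i)"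
proof -
  have "\<forall>i. \<exists>e. \<exists>d :: 'a \<Rightarrow> complex. i < N \<longrightarrow>
      e \<in> R h i i \<and> linear_on UNIV UNIV d \<and> (\<forall>x\<in>R h i i. x = d x *\<^sub>C e)"
    using entry_one_dim[OF h] by blast
  then show ?thesis unfolding choice_iff by blast
qed

section \<open>The tensor obtained from the unit, and the components of \<psi>\<close>

lemma linear_counit_tensor:
  assumes g: "g \<in> carrier G" and i: "i < N"
  shows "linear_on UNIV (comp2 N (R g) (R (inv g)) i i) (counit_tensor G \<rho> g i)"
proof -
  have l1: "linear_on UNIV (R \<one> i i) (inv2 (R \<one>) (rphi1 \<rho>) i i)"
    using is_mor2D[OF is_mor2_inv2[OF mat2[OF one_closed] phi1_iso] i i] by (simp add: one2_def)
  have "is_iso2 N (comp2 N (R g) (R (inv g))) (R \<one>) (rphi \<rho> g (inv g))"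
    using phi_iso[of g "inv g"] g by simp
  from linear_on_compose[OF l1 is_mor2D[OF is_mor2_inv2[OF is_mat2_comp2 this] i i]]
  show ?thesis unfolding counit_tensor_def .
qed

lemma counit_tensor_entry:
  "g \<in> carrier G \<Longrightarrow> i < N \<Longrightarrow> l < N
    \<Longrightarrow> counit_tensor G \<rho> g i c l \<in> tensor_space (R g i l) (R (inv g) l i)"
  using comp2_entry[OF linear_on_mem[OF linear_counit_tensor UNIV_I]] .

text \<open>Both inverses in \<open>counit_tensor\<close> are inverses of bijections, so a tensor
  with the right images under \<phi> and \<open>rphi1\<close> must be the one. Candidates for \<rho>
  \<oplus> \<rho>' and \<rho> \<otimes> \<rho>' are checked in this way.\<close>

lemma counit_tensor_eqI:
  assumes g: "g \<in> carrier G" and i: "i < N" and t: "t \<in> comp2 N (R g) (R (inv g)) i i"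
    and u: "u \<in> R \<one> i i" and tu: "rphi \<rho> g (inv g) i i t = u" and uc: "rphi1 \<rho> i i u = c"
  shows "counit_tensor G \<rho> g i c = t"
proof -
  have iso: "is_iso2 N (comp2 N (R g) (R (inv g))) (R \<one>) (rphi \<rho> g (inv g))"
    using phi_iso[of g "inv g"] g by simp
  have "inv2 (R \<one>) (rphi1 \<rho>) i i c = u"
    by (rule inv2_eqI[OF phi1_iso i i u]) (rule uc)
  moreover have "inv2 (comp2 N (R g) (R (inv g))) (rphi \<rho> g (inv g)) i i u = t"
    by (rule inv2_eqI[OF iso i i t]) (rule tu)
  ultimately show ?thesis by (simp add: counit_tensor_def)
qed

lemma counit_tensor_inverse:
  assumes g: "g \<in> carrier G" and i: "i < N"
  shows "rphi \<rho> g (inv g) i i (counit_tensor G \<rho> g i c) \<in> R \<one> i i"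
    and "rphi1 \<rho> i i (rphi \<rho> g (inv g) i i (counit_tensor G \<rho> g i c)) = c"
proof -
  have iso: "is_iso2 N (comp2 N (R g) (R (inv g))) (R \<one>) (rphi \<rho> g (inv g))"
    using phi_iso[of g "inv g"] g by simp
  have c: "c \<in> one2 i i" by (simp add: one2_def)
  have u: "inv2 (R \<one>) (rphi1 \<rho>) i i c \<in> R \<one> i i"
    using linear_on_mem[OF is_mor2D[OF is_mor2_inv2[OF mat2[OF one_closed] phi1_iso] i i] c] .
  show "rphi \<rho> g (inv g) i i (counit_tensor G \<rho> g i c) \<in> R \<one> i i"
    "rphi1 \<rho> i i (rphi \<rho> g (inv g) i i (counit_tensor G \<rho> g i c)) = c"
    unfolding counit_tensor_def using u by (simp_all add: inv2_right[OF iso i i u] inv2_right[OF phi1_iso i i c])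
qed

text \<open>The three whiskered factors of \<open>psi\<close> act on each summand l separately, with
  the identity on the left tensor factor. They merge into one \<open>tensor_map\<close> whose right
  factor sends b to 1 \<otimes> b, then to \<sigma>_ll(1) \<otimes> b, and then through
  \<phi>.\<close>

lemma psi_entry:
  assumes g: "g \<in> carrier G" and h: "h \<in> carrier G" and \<sigma>: "\<sigma> \<in> cat_trace N (R h)" and i: "i < N"
  shows "psi G \<rho> g h \<sigma> i i c = rphi \<rho> g (h \<otimes> inv g) i i (\<lambda>l. if l < N then
      tensor_map (R g i l) (R (inv g) l i) (\<lambda>a. a)
        (\<lambda>b. rphi \<rho> h (inv g) l i (coord_inj l (\<sigma> l l 1 \<otimes>\<^sub>v b))) (counit_tensor G \<rho> g i c l) else 0)"
proof -
  have k: "inv g \<in> carrier G" using g by simp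
  note \<sigma>' = cat_trace_mor2[OF \<sigma>]
  let ?k = "inv g"
  let ?t = "counit_tensor G \<rho> g i c"
  let ?W1 = "\<lambda>l. comp2 N one2 (R ?k) l i" and ?W2 = "\<lambda>l. comp2 N (R h) (R ?k) l i"
  let ?L = "\<lambda>l. inv2 (comp2 N one2 (R ?k)) left_unitor l i" and ?S = "\<lambda>l. hcomp N one2 (R ?k) \<sigma> id2 l i"
  let ?P = "\<lambda>l. rphi \<rho> h ?k l i"
  have "tensor_map (R g i l) (?W2 l) (id2 i l) (?P l)
          (tensor_map (R g i l) (?W1 l) (id2 i l) (?S l)
            (tensor_map (R g i l) (R ?k l i) (id2 i l) (?L l) (?t l)))
      = tensor_map (R g i l) (R ?k l i) (\<lambda>a. a) (\<lambda>b. ?P l (coord_inj l (\<sigma> l l 1 \<otimes>\<^sub>v b))) (?t l)"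
    if l: "l < N" for l
  proof -
    note A = space[OF g i l] and B = space[OF k l i]
    have id: "linear_on (R g i l) (R g i l) (id2 i l)" by (simp add: linear_on_def id2_def)
    have L: "linear_on (R ?k l i) (?W1 l) (?L l)"
      using is_mor2D[OF is_mor2_inv2[OF is_mat2_comp2 is_iso2_left_unitor[OF mat2[OF k]]] l i] .
    have S: "linear_on (?W1 l) (?W2 l) (?S l)"
      using is_mor2D[OF is_mor2_hcomp[OF is_mat2_one2 mat2[OF k] \<sigma>' is_mor2_id2] l i] .
    note P = linear_phi[OF h k l i]
    note t = counit_tensor_entry[OF g i l, of c]
    have "tensor_map (R g i l) (?W2 l) (id2 i l) (?P l)
          (tensor_map (R g i l) (?W1 l) (id2 i l) (?S l)
            (tensor_map (R g i l) (R ?k l i) (id2 i l) (?L l) (?t l)))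
        = tensor_map (R g i l) (R ?k l i) (\<lambda>a. id2 i l (id2 i l (id2 i l a))) (\<lambda>b. ?P l (?S l (?L l b))) (?t l)"
      by (simp add: tensor_map_compose[OF A A B csubspace_comp2 id id L S t]
        tensor_map_compose[OF A A B csubspace_comp2 linear_on_compose[OF id id] id linear_on_compose[OF L S] P t])
    also have "\<dots> = tensor_map (R g i l) (R ?k l i) (\<lambda>a. a) (\<lambda>b. ?P l (coord_inj l (\<sigma> l l 1 \<otimes>\<^sub>v b))) (?t l)"
    proof (rule tensor_map_cong[OF A B linear_on_compose[OF linear_on_compose[OF id id] id]
          linear_on_compose[OF linear_on_compose[OF L S] P] _ _ t])
      fix b assume b: "b \<in> R ?k l i"
      \<comment> \<open>The inverse unitor puts b at coordinate l, and whiskering \<sigma> keeps it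
        there: at any other coordinate a linear map is applied to 0.\<close>
      have "?S l (coord_inj l (1 \<otimes>\<^sub>v b)) = coord_inj l (\<sigma> l l 1 \<otimes>\<^sub>v b)"
      proof
        fix m
        show "?S l (coord_inj l (1 \<otimes>\<^sub>v b)) m = coord_inj l (\<sigma> l l 1 \<otimes>\<^sub>v b) m"
        proof (cases "m < N")
          case m: True
          have idm: "linear_on (R ?k m i) (R ?k m i) (id2 m i)" by (simp add: linear_on_def id2_def)
          note T = is_mat2D[OF is_mat2_one2 l m] space[OF k m i] is_mor2D[OF \<sigma>' l m] idm
          show ?thesis
          proof (cases "m = l")
            case True
            then show ?thesis using b l tensor_map_tensor[OF T, of 1 b]
              by (simp add: hcomp_def one2_def id2_def)
          next
            case False
            then show ?thesis using m linear_on_0[OF csubspace_tensor_space linear_tensor_map[OF T]]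
              by (simp add: hcomp_def)
          qed
        next
          case False
          then show ?thesis using l by (auto simp: hcomp_def coord_inj_def)
        qed
      qed
      then show "?P l (?S l (?L l b)) = ?P l (coord_inj l (\<sigma> l l 1 \<otimes>\<^sub>v b))"
        by (simp add: inv2_left_unitor[OF mat2[OF k] l i b])
    qed (simp add: id2_def)
    finally show ?thesis .
  qed
  then show ?thesis
    by (simp add: psi_def Let_def restrict2_def vcomp_def one2_def[of i i] i hcomp_def[of _ "R g"]
        counit_tensor_def[symmetric] cong: if_cong)
qed

lemma psi_mem:
  assumes g: "g \<in> carrier G" and h: "h \<in> carrier G" and \<sigma>: "\<sigma> \<in> cat_trace N (R h)"
  shows "psi G \<rho> g h \<sigma> \<in> cat_trace N (R (g \<otimes> (h \<otimes> inv g)))"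
  unfolding psi_def Let_def
proof (rule restrict2_in_cat_trace)
  have k: "inv g \<in> carrier G" using g by simp
  have P: "is_mor2 N (comp2 N (R a) (R b)) (R (a \<otimes> b)) (rphi \<rho> a b)"
    if "a \<in> carrier G" "b \<in> carrier G" for a b using phi_iso[OF that] by (simp add: is_iso2_def)
  have iso: "is_iso2 N (comp2 N (R g) (R (inv g))) (R \<one>) (rphi \<rho> g (inv g))"
    using phi_iso[of g "inv g"] g by simp
  show "is_mor2 N one2 (R (g \<otimes> (h \<otimes> inv g)))
     (rphi \<rho> g (h \<otimes> inv g) \<bullet> hcomp N (R g) (comp2 N (R h) (R (inv g))) id2 (rphi \<rho> h (inv g))
        \<bullet> hcomp N (R g) (comp2 N one2 (R (inv g))) id2 (hcomp N one2 (R (inv g)) \<sigma> id2)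
        \<bullet> hcomp N (R g) (R (inv g)) id2 (inv2 (comp2 N one2 (R (inv g))) left_unitor)
        \<bullet> inv2 (comp2 N (R g) (R (inv g))) (rphi \<rho> g (inv g))
        \<bullet> inv2 (R \<one>) (rphi1 \<rho>))"
    by (rule is_mor2_vcomp is_mor2_inv2 is_mor2_hcomp mat2 is_mat2_comp2 is_mat2_one2 iso phi1_iso
        is_iso2_left_unitor P g h k m_closed one_closed is_mor2_id2 cat_trace_mor2[OF \<sigma>])+
qed


lemma linear_psi_entry:
  assumes g: "g \<in> carrier G" and h: "h \<in> carrier G" and i: "i < N"
  shows "linear_on (cat_trace N (R h)) UNIV (\<lambda>\<sigma>. psi G \<rho> g h \<sigma> i i c)"
proof (rule linear_onI)
  have k: "inv g \<in> carrier G" and hk: "h \<otimes> inv g \<in> carrier G" using g h by simp_all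
  let ?k = "inv g" and ?t = "counit_tensor G \<rho> g i c"
  let ?P = "\<lambda>x l b. rphi \<rho> h ?k l i (coord_inj l (x \<otimes>\<^sub>v b))"
  let ?T = "\<lambda>\<sigma> l. tensor_map (R g i l) (R ?k l i) (\<lambda>a. a) (?P (\<sigma> l l 1) l) (?t l)"
  let ?U = "\<lambda>\<sigma> l. if l < N then ?T \<sigma> l else 0"
  have P: "linear_on (R ?k l i) (R (h \<otimes> ?k) l i) (?P (\<sigma> l l 1) l)"
    if "l < N" "\<sigma> \<in> cat_trace N (R h)" for l \<sigma>
    using linear_phi_coord[OF h k that(1) i that(1) cat_trace_entry[OF that(2,1)]] .
  have U: "?U \<sigma> \<in> comp2 N (R g) (R (h \<otimes> ?k)) i i" if \<sigma>: "\<sigma> \<in> cat_trace N (R h)" for \<sigma>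
    using linear_on_mem[OF linear_tensor_map[OF space[OF g i] space[OF k _ i] linear_on_id P[OF _ \<sigma>]]
        counit_tensor_entry[OF g i]] by (auto simp: comp2_def)
  note \<Phi> = linear_phi[OF g hk i i]
  note C = csubspace_cat_trace[OF mat2[OF h]]
  \<comment> \<open>Linearity in the whole tensor, which gives additivity in its left factor, the
    one that depends on \<sigma>; the fact \<open>P\<close> fixes that factor.\<close>
  have L: "linear_on (tensor_space (R h l l) (R ?k l i)) (R (h \<otimes> ?k) l i) (\<lambda>s. rphi \<rho> h ?k l i (coord_inj l s))"
    if "l < N" for l
    using linear_on_compose[OF linear_coord_inj_comp2[OF that, of "R h" l "R ?k" i] linear_phi[OF h k that i]] .
  fix \<sigma> assume \<sigma>: "\<sigma> \<in> cat_trace N (R h)"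
  show "psi G \<rho> g h (z *\<^sub>C \<sigma>) i i c = z *\<^sub>C psi G \<rho> g h \<sigma> i i c" for z
  proof -
    have z\<sigma>: "z *\<^sub>C \<sigma> \<in> cat_trace N (R h)" using csubspace_scale[OF C \<sigma>] .
    have "?T (z *\<^sub>C \<sigma>) l = z *\<^sub>C ?T \<sigma> l" if l: "l < N" for l
    proof -
      note A = space[OF g i l] and B = space[OF k l i] and t = counit_tensor_entry[OF g i l, of c]
      have "?T (z *\<^sub>C \<sigma>) l = tensor_map (R g i l) (R ?k l i) (\<lambda>a. a) (\<lambda>b. z *\<^sub>C ?P (\<sigma> l l 1) l b) (?t l)"
        by (rule tensor_map_cong[OF A B linear_on_id P[OF l z\<sigma>] _ _ t])
          (simp_all add: scaleC_fun_def tensor_scale_left linear_on_scale[OF L[OF l]] tensor_in_space cat_trace_entry[OF \<sigma> l])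
      then show ?thesis by (simp add: tensor_map_scale_right[OF A B linear_on_id P[OF l \<sigma>] t])
    qed
    then have "?U (z *\<^sub>C \<sigma>) = z *\<^sub>C ?U \<sigma>" by (auto simp: scaleC_fun_def)
    then show ?thesis
      by (simp only: psi_entry[OF g h \<sigma> i] psi_entry[OF g h z\<sigma> i] linear_on_scale[OF \<Phi> U[OF \<sigma>]])
  qed
  fix \<tau> assume \<tau>: "\<tau> \<in> cat_trace N (R h)"
  have \<sigma>\<tau>: "\<sigma> + \<tau> \<in> cat_trace N (R h)" using csubspace_add[OF C \<sigma> \<tau>] .
  have "?T (\<sigma> + \<tau>) l = ?T \<sigma> l + ?T \<tau> l" if l: "l < N" for l
  proof -
    note A = space[OF g i l] and B = space[OF k l i] and t = counit_tensor_entry[OF g i l, of c]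
    have "?T (\<sigma> + \<tau>) l
        = tensor_map (R g i l) (R ?k l i) (\<lambda>a. a) (\<lambda>b. ?P (\<sigma> l l 1) l b + ?P (\<tau> l l 1) l b) (?t l)"
      by (rule tensor_map_cong[OF A B linear_on_id P[OF l \<sigma>\<tau>] _ _ t])
        (simp_all add: tensor_add_left linear_on_add[OF L[OF l]] tensor_in_space cat_trace_entry[OF \<sigma> l]
          cat_trace_entry[OF \<tau> l])
    then show ?thesis by (simp add: tensor_map_add_right[OF A B linear_on_id P[OF l \<sigma>] P[OF l \<tau>] t])
  qed
  then have "?U (\<sigma> + \<tau>) = ?U \<sigma> + ?U \<tau>" by auto
  then show "psi G \<rho> g h (\<sigma> + \<tau>) i i c = psi G \<rho> g h \<sigma> i i c + psi G \<rho> g h \<tau> i i c"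
    by (simp only: psi_entry[OF g h \<sigma> i] psi_entry[OF g h \<tau> i] psi_entry[OF g h \<sigma>\<tau> i]
        linear_on_add[OF \<Phi> U[OF \<sigma>] U[OF \<tau>]])
qed simp

section \<open>Diagonal components and the trace of \<psi>\<close>

lemma linear_diag_mult:
  "g \<in> carrier G \<Longrightarrow> h \<in> carrier G \<Longrightarrow> i < N \<Longrightarrow> a \<in> R g i i
    \<Longrightarrow> linear_on (R h i i) (R (g \<otimes> h) i i) (diag_mult \<rho> g h i a)"
  using linear_phi_coord unfolding diag_mult_def by blast

lemma linear_diag_psi:
  assumes g: "g \<in> carrier G" and h: "h \<in> carrier G" and i: "i < N" and x: "x \<in> R h i i"
  shows "linear_on (tensor_space (R g i i) (R (inv g) i i)) (R (g \<otimes> (h \<otimes> inv g)) i i) (diag_psi G \<rho> g h i x)"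
proof -
  have k: "inv g \<in> carrier G" and hk: "h \<otimes> inv g \<in> carrier G" using g h by simp_all
  note T = linear_tensor_map[OF space[OF g i i] space[OF k i i] linear_on_id linear_diag_mult[OF h k i x]]
  show ?thesis
    using linear_on_compose[OF linear_on_compose[OF T linear_coord_inj_comp2[OF i, of "R g" i "R (h \<otimes> inv g)" i]] linear_phi[OF g hk i i]]
    unfolding diag_psi_def .
qed

lemma diag_psi_tensor:
  assumes g: "g \<in> carrier G" and h: "h \<in> carrier G" and i: "i < N" and x: "x \<in> R h i i"
    and a: "a \<in> R g i i" and b: "b \<in> R (inv g) i i"
  shows "diag_psi G \<rho> g h i x (a \<otimes>\<^sub>v b)
    = diag_mult \<rho> g (h \<otimes> inv g) i a (diag_mult \<rho> h (inv g) i x b)"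
proof -
  have k: "inv g \<in> carrier G" using g by simp
  show ?thesis
    unfolding diag_psi_def
      tensor_map_tensor[OF space[OF g i i] space[OF k i i] linear_on_id linear_diag_mult[OF h k i x] a b]
    by (simp add: diag_mult_def)
qed

text \<open>A frame of the diagonal entries induces one of the categorical trace: the elements
  \<open>E i\<close> carrying \<open>e i\<close> at place i, with the functionals \<sigma> \<mapsto>
  d_i(\<sigma>_ii(1)). Then \<open>linear_trace_frame\<close> applies.\<close>

lemma character2_eq:
  assumes g: "g \<in> carrier G" and h: "h \<in> carrier G" and comm: "g \<otimes> h = h \<otimes> g"
    and e: "\<And>i. i < N \<Longrightarrow> e i \<in> R h i i"
    and d: "\<And>i. i < N \<Longrightarrow> linear_on (R h i i) (UNIV :: complex set) (d i)"
    and frame: "\<And>i x. i < N \<Longrightarrow> x \<in> R h i i \<Longrightarrow> x = d i x *\<^sub>C e i"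
  shows "character2 G \<rho> g h = (\<Sum>i<N. d i (diag_psi G \<rho> g h i (e i) (counit_tensor G \<rho> g i 1 i)))"
proof -
  let ?V = "cat_trace N (R h)"
  have k: "inv g \<in> carrier G" and hk: "h \<otimes> inv g \<in> carrier G" using g h by simp_all
  \<comment> \<open>Here commutativity makes \<psi> an endomorphism. The first \<open>simp\<close>
    brackets to the left to expose the product of g and h, the second brackets back to cancel g
    against its inverse.\<close>
  have ghk: "g \<otimes> (h \<otimes> inv g) = h"
    using g h k comm by (simp add: m_assoc[symmetric]) (simp add: m_assoc)
  define E :: "nat \<Rightarrow> (complex, 'a) mor2" where
    "E i = (\<lambda>p q c. if p = i \<and> q = i then c *\<^sub>C e i else 0)" for i
  have E: "E i \<in> ?V" if i: "i < N" for i
  proof -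
    have "is_mor2 N one2 (R h) (E i)"
      by (auto simp: is_mor2_def linear_on_def E_def one2_def i e space csubspace_0[OF space[OF h]]
          csubspace_scale[OF space[OF h]] scaleC_add_left scaleC_scaleC scaleC_complex_def)
    moreover have "restrict2 N one2 (E i) = E i"
      using i by (auto simp: fun_eq_iff restrict2_def E_def one2_def)
    ultimately show ?thesis by (simp add: cat_trace_def hom2_def)
  qed
  note C = csubspace_cat_trace[OF mat2[OF h]]
  have psi: "psi G \<rho> g h \<sigma> \<in> ?V" if "\<sigma> \<in> ?V" for \<sigma>
    using psi_mem[OF g h that] by (simp add: ghk)
  have lin: "linear_on ?V ?V (psi G \<rho> g h)"
  proof (rule linear_onI)
    fix \<sigma> assume \<sigma>: "\<sigma> \<in> ?V"
    then show "psi G \<rho> g h \<sigma> \<in> ?V" by (rule psi)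
    show "psi G \<rho> g h (z *\<^sub>C \<sigma>) = z *\<^sub>C psi G \<rho> g h \<sigma>" for z
      by (rule cat_trace_ext[OF psi[OF csubspace_scale[OF C \<sigma>]] csubspace_scale[OF C psi[OF \<sigma>]]])
        (simp add: linear_on_scale[OF linear_psi_entry[OF g h] \<sigma>] scaleC_fun_apply)
    show "psi G \<rho> g h (\<sigma> + \<tau>) = psi G \<rho> g h \<sigma> + psi G \<rho> g h \<tau>" if \<tau>: "\<tau> \<in> ?V" for \<tau>
      by (rule cat_trace_ext[OF psi[OF csubspace_add[OF C \<sigma> \<tau>]] csubspace_add[OF C psi[OF \<sigma>] psi[OF \<tau>]]])
        (simp add: linear_on_add[OF linear_psi_entry[OF g h] \<sigma> \<tau>])
  qed
  have "linear_trace ?V (psi G \<rho> g h) = (\<Sum>i<N. d i (psi G \<rho> g h (E i) i i 1))"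
  proof (rule linear_trace_frame[OF C lin])
    fix i assume "i \<in> {..<N}"
    then have i: "i < N" by simp
    show "E i \<in> ?V" by (rule E[OF i])
    show "linear_on ?V UNIV (\<lambda>\<sigma>. d i (\<sigma> i i 1))"
      by (rule linear_onI)
        (simp_all add: scaleC_fun_def linear_on_add[OF d[OF i]] linear_on_scale[OF d[OF i]] cat_trace_entry[OF _ i])
  next
    fix \<sigma> assume \<sigma>: "\<sigma> \<in> ?V"
    show "\<sigma> = (\<Sum>i<N. d i (\<sigma> i i 1) *\<^sub>C E i)"
    proof (rule cat_trace_ext[OF \<sigma>])
      show "(\<Sum>i<N. d i (\<sigma> i i 1) *\<^sub>C E i) \<in> ?V"
        by (intro csubspace_sum[OF C] csubspace_scale[OF C] E) simp
      fix p assume p: "p < N"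
      have "(\<Sum>i<N. d i (\<sigma> i i 1) *\<^sub>C E i) p p 1 = (\<Sum>i<N. if i = p then d p (\<sigma> p p 1) *\<^sub>C e p else 0)"
        unfolding sum_fun_apply by (rule sum.cong) (auto simp: scaleC_fun_def E_def scaleC_one)
      then show "\<sigma> p p 1 = (\<Sum>i<N. d i (\<sigma> i i 1) *\<^sub>C E i) p p 1"
        using frame[OF p cat_trace_entry[OF \<sigma> p]] p by simp
    qed
  qed simp
  also have "\<dots> = (\<Sum>i<N. d i (diag_psi G \<rho> g h i (e i) (counit_tensor G \<rho> g i 1 i)))"
  proof (rule sum.cong[OF refl])
    fix i assume "i \<in> {..<N}"
    then have i: "i < N" by simp
    \<comment> \<open>Since \<open>E i\<close> vanishes at every l other than i, only the coordinate
      l = i of the argument of \<phi> survives; this brings in \<open>diag_psi\<close>.\<close>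
    have "tensor_map (R g i l) (R (inv g) l i) (\<lambda>a. a)
        (\<lambda>b. rphi \<rho> h (inv g) l i (coord_inj l (E i l l 1 \<otimes>\<^sub>v b))) (counit_tensor G \<rho> g i 1 l)
      = coord_inj i (tensor_map (R g i i) (R (inv g) i i) (\<lambda>a. a) (diag_mult \<rho> h (inv g) i (e i))
          (counit_tensor G \<rho> g i 1 i)) l" if l: "l < N" for l
    proof (cases "l = i")
      case True
      then show ?thesis by (simp add: E_def scaleC_one diag_mult_def[abs_def])
    next
      case False
      then have "E i l l 1 = 0" by (simp add: E_def)
      moreover have "rphi \<rho> h (inv g) l i 0 = 0"
        by (rule linear_on_0[OF csubspace_comp2 linear_phi[OF h k l i]])
      ultimately show ?thesis
        using False tensor_map_zero_right[OF space[OF g i l] space[OF k l i] linear_on_id counit_tensor_entry[OF g i l]]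
        by simp
    qed
    then have "(\<lambda>l. if l < N then tensor_map (R g i l) (R (inv g) l i) (\<lambda>a. a)
        (\<lambda>b. rphi \<rho> h (inv g) l i (coord_inj l (E i l l 1 \<otimes>\<^sub>v b))) (counit_tensor G \<rho> g i 1 l) else 0)
      = coord_inj i (tensor_map (R g i i) (R (inv g) i i) (\<lambda>a. a) (diag_mult \<rho> h (inv g) i (e i))
          (counit_tensor G \<rho> g i 1 i))"
      using i by (auto simp: fun_eq_iff coord_inj_def)
    then show "d i (psi G \<rho> g h (E i) i i 1) = d i (diag_psi G \<rho> g h i (e i) (counit_tensor G \<rho> g i 1 i))"
      by (simp only: psi_entry[OF g h E[OF i] i] diag_psi_def)
  qed
  finally show ?thesis unfolding character2_def .
qed

end


section \<open>Direct sums\<close>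

lemma is_mat2_dsum:
  "is_mat2 n A \<Longrightarrow> is_mat2 n' A' \<Longrightarrow> is_mat2 (n + n') (dsum_mat2 n A A')"
  by (auto simp: is_mat2_def dsum_mat2_def)

lemma is_iso2_dsum:
  assumes "is_iso2 n A B \<sigma>" "is_iso2 n' A' B' \<sigma>'"
  shows "is_iso2 (n + n') (dsum_mat2 n A A') (dsum_mat2 n B B') (dsum_mor2 n \<sigma> \<sigma>')"
  using assms unfolding is_iso2_def is_mor2_def
  by (auto simp: dsum_mat2_def dsum_mor2_def linear_on_def bij_betw_def)

lemma dsum_one2: "dsum_mat2 n one2 one2 = one2"
  by (auto simp: fun_eq_iff dsum_mat2_def one2_def)

text \<open>For a middle index k from n on, both tensor factors are 0, which forces the coordinate
  to be 0; \<open>comp2\<close> for size n demands the same. So the two spaces agree as sets, not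
  merely up to isomorphism.\<close>

lemma comp2_dsum_first:
  assumes "i < n" "j < n"
  shows "comp2 (n + n') (dsum_mat2 n A A') (dsum_mat2 n B B') i j = comp2 n A B i j"
proof -
  have "t k \<in> tensor_space (dsum_mat2 n A A' i k) (dsum_mat2 n B B' k j) \<longleftrightarrow>
      (if k < n then t k \<in> tensor_space (A i k) (B k j) else t k = 0)" for t k
    using assms by (simp add: dsum_mat2_def)
  moreover have "(\<forall>k<n + n'. if k < n then P k else Q k) \<and> (\<forall>k\<ge>n + n'. Q k)
      \<longleftrightarrow> (\<forall>k<n. P k) \<and> (\<forall>k\<ge>n. Q k)" for P Q
    by (smt (verit, best) le_add1 le_trans not_le)
  ultimately show ?thesis by (simp add: comp2_def)
qed

text \<open>Here the coordinates are shifted by n, so membership is compared instead of the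
  sets.\<close>

lemma comp2_dsum_second:
  "t \<in> comp2 (n + n') (dsum_mat2 n A A') (dsum_mat2 n B B') (n + i) (n + j)
    \<longleftrightarrow> (\<forall>k<n. t k = 0) \<and> (\<lambda>k. t (n + k)) \<in> comp2 n' A' B' i j"
proof -
  have *: "t k \<in> tensor_space (dsum_mat2 n A A' (n + i) k) (dsum_mat2 n B B' k (n + j)) \<longleftrightarrow>
      (if k < n then t k = 0 else t k \<in> tensor_space (A' i (k - n)) (B' (k - n) j))" for k
    by (simp add: dsum_mat2_def)
  have "(\<forall>k<n + n'. P k) \<longleftrightarrow> (\<forall>k<n. P k) \<and> (\<forall>k<n'. P (n + k))" for P
    by (metis add_diff_inverse_nat nat_add_left_cancel_less trans_less_add1)
  moreover have "(\<forall>k\<ge>n + n'. P k) \<longleftrightarrow> (\<forall>k\<ge>n'. P (n + k))" for P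
    by (metis add_le_cancel_left le_Suc_ex add.assoc)
  ultimately show ?thesis by (simp add: comp2_def *)
qed

text \<open>Any middle index lies in the block of i or in that of j, so one of the two tensor
  factors is an off-diagonal 0.\<close>

lemma comp2_dsum_off:
  assumes "i < n \<longleftrightarrow> \<not> j < n"
  shows "comp2 (n + n') (dsum_mat2 n A A') (dsum_mat2 n B B') i j = {0}"
proof -
  have "tensor_space (dsum_mat2 n A A' i k) (dsum_mat2 n B B' k j) = {0}" for k
    using assms by (auto simp: dsum_mat2_def)
  then show ?thesis by (auto simp: comp2_def fun_eq_iff) (meson not_less)
qed

text \<open>The interchange is the identity on the first block, drops n leading zeros on the second
  one, and is a map between zero spaces elsewhere.\<close>

lemma is_iso2_dsum_interchange:
  "is_iso2 (n + n') (comp2 (n + n') (dsum_mat2 n A A') (dsum_mat2 n B B'))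
     (dsum_mat2 n (comp2 n A B) (comp2 n' A' B')) (dsum_interchange n)"
proof -
  have "linear_on (comp2 (n + n') (dsum_mat2 n A A') (dsum_mat2 n B B') i j)
        (dsum_mat2 n (comp2 n A B) (comp2 n' A' B') i j) (dsum_interchange n i j)
      \<and> bij_betw (dsum_interchange n i j) (comp2 (n + n') (dsum_mat2 n A A') (dsum_mat2 n B B') i j)
        (dsum_mat2 n (comp2 n A B) (comp2 n' A' B') i j)"
    (is "linear_on ?C ?D ?f \<and> bij_betw ?f ?C ?D") for i j
  proof -
    consider "i < n" "j < n" | "n \<le> i" "n \<le> j" | "i < n \<longleftrightarrow> \<not> j < n" by linarith
    then show ?thesis
    proof cases
      case 1
      then have f: "?f t = t" if "t \<in> comp2 n A B i j" for t
        using comp2_outside[OF that] by (auto simp: dsum_interchange_def dsum_mor2_def)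
      have C: "?C = comp2 n A B i j" and D: "?D = comp2 n A B i j"
        using 1 by (simp_all add: comp2_dsum_first dsum_mat2_def)
      have "linear_on ?C ?D ?f"
        unfolding C D by (rule linear_on_cong[OF csubspace_comp2 linear_on_id]) (simp add: f)
      moreover have "bij_betw ?f ?C ?D"
        unfolding C D using bij_betw_cong[of "comp2 n A B i j" ?f id] f by (simp add: bij_betw_id)
      ultimately show ?thesis ..
    next
      case 2
      then obtain a b where ab: "i = n + a" "j = n + b" using le_Suc_ex by blast
      have f: "?f t = (\<lambda>k. t (n + k))" for t
        by (simp add: ab dsum_interchange_def dsum_mor2_def)
      have D: "?D = comp2 n' A' B' a b" by (simp add: ab dsum_mat2_def)
      have C: "t \<in> ?C \<longleftrightarrow> (\<forall>k<n. t k = 0) \<and> ?f t \<in> ?D" for t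
        by (simp add: D f) (simp add: ab comp2_dsum_second)
      have "linear_on ?C ?D ?f"
        by (rule linear_onI) (simp_all add: C, simp_all add: f fun_eq_iff scaleC_fun_apply)
      moreover have "bij_betw ?f ?C ?D"
      \<comment> \<open>The inverse restores the n leading zeros.\<close>
      proof (rule bij_betw_byWitness[where f' = "\<lambda>t k. if k < n then 0 else t (k - n)"])
        show "\<forall>t\<in>?C. (\<lambda>k. if k < n then 0 else ?f t (k - n)) = t"
          by (auto simp: C) (auto simp: f fun_eq_iff)
      qed (auto simp: C f)
      ultimately show ?thesis ..
    next
      case 3
      then have "?C = {0}" and "?D = {0}" and "?f 0 = 0"
        by (auto simp: comp2_dsum_off dsum_mat2_def dsum_interchange_def dsum_mor2_def fun_eq_iff)
      then show ?thesis by (auto simp: linear_on_def bij_betw_def)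
    qed
  qed
  then show ?thesis unfolding is_iso2_def is_mor2_def by blast
qed

lemma dsum_rep_simps:
  "rdim (dsum_rep \<rho> \<rho>') = rdim \<rho> + rdim \<rho>'"
  "rmor (dsum_rep \<rho> \<rho>') g = dsum_mat2 (rdim \<rho>) (rmor \<rho> g) (rmor \<rho>' g)"
  "rphi (dsum_rep \<rho> \<rho>') g h = dsum_mor2 (rdim \<rho>) (rphi \<rho> g h) (rphi \<rho>' g h) \<bullet> dsum_interchange (rdim \<rho>)"
  "rphi1 (dsum_rep \<rho> \<rho>') = dsum_mor2 (rdim \<rho>) (rphi1 \<rho>) (rphi1 \<rho>')"
  by (simp_all add: dsum_rep_def Let_def)

lemma two_rep_isos_dsum:
  assumes "two_rep_isos G \<rho>" "two_rep_isos G \<rho>'"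
  shows "two_rep_isos G (dsum_rep \<rho> \<rho>')"
proof -
  interpret r: two_rep_isos G \<rho> by fact
  interpret r': two_rep_isos G \<rho>' by fact
  show ?thesis
    by unfold_locales
      (auto simp: dsum_rep_simps intro!: is_mat2_dsum r.mat2 r'.mat2
        is_iso2_dsum[OF r.phi1_iso r'.phi1_iso, unfolded dsum_one2]
        is_iso2_vcomp[OF is_iso2_dsum_interchange is_iso2_dsum[OF r.phi_iso r'.phi_iso]])
qed

lemma sum_lessThan_add: "(\<Sum>p<n + n'. f p) = (\<Sum>p<n. f p) + (\<Sum>q<n'. f (n + q))"
  for f :: "nat \<Rightarrow> 'a::comm_monoid_add"
  by (induction n') (simp_all add: add.assoc)

context
  fixes G (structure) and \<rho> \<rho>' :: "('g, 'a::complex_vector) rep2"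
  assumes \<rho>: "two_rep_isos G \<rho>" and \<rho>': "two_rep_isos G \<rho>'"
begin

interpretation r: two_rep_isos G \<rho> by (rule \<rho>)
interpretation r': two_rep_isos G \<rho>' by (rule \<rho>')
interpretation s: two_rep_isos G "dsum_rep \<rho> \<rho>'" by (rule two_rep_isos_dsum[OF \<rho> \<rho>'])

section \<open>Components of a direct sum\<close>

lemma rmor_dsum:
  "p < rdim \<rho> \<Longrightarrow> rmor (dsum_rep \<rho> \<rho>') g p p = rmor \<rho> g p p"
  "rmor (dsum_rep \<rho> \<rho>') g (rdim \<rho> + q) (rdim \<rho> + q) = rmor \<rho>' g q q"
  by (simp_all add: dsum_rep_simps dsum_mat2_def)

lemma rphi_dsum_coord:
  "p < rdim \<rho> \<Longrightarrow> rphi (dsum_rep \<rho> \<rho>') g h p p (coord_inj p x) = rphi \<rho> g h p p (coord_inj p x)"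
  "rphi (dsum_rep \<rho> \<rho>') g h (rdim \<rho> + q) (rdim \<rho> + q) (coord_inj (rdim \<rho> + q) x)
    = rphi \<rho>' g h q q (coord_inj q x)"
proof -
  assume p: "p < rdim \<rho>"
  then have "(\<lambda>k. if k < rdim \<rho> then coord_inj p x k else 0) = coord_inj p x"
    by (auto simp: coord_inj_def)
  then show "rphi (dsum_rep \<rho> \<rho>') g h p p (coord_inj p x) = rphi \<rho> g h p p (coord_inj p x)"
    using p by (simp add: dsum_rep_simps vcomp_def dsum_interchange_def dsum_mor2_def)
next
  have "(\<lambda>k. coord_inj (rdim \<rho> + q) x (rdim \<rho> + k)) = coord_inj q x"
    by (auto simp: coord_inj_def)
  then show "rphi (dsum_rep \<rho> \<rho>') g h (rdim \<rho> + q) (rdim \<rho> + q) (coord_inj (rdim \<rho> + q) x)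
    = rphi \<rho>' g h q q (coord_inj q x)"
    by (simp add: dsum_rep_simps vcomp_def dsum_interchange_def dsum_mor2_def)
qed

lemma diag_psi_dsum:
  "p < rdim \<rho> \<Longrightarrow> diag_psi G (dsum_rep \<rho> \<rho>') g h p x s = diag_psi G \<rho> g h p x s"
  "diag_psi G (dsum_rep \<rho> \<rho>') g h (rdim \<rho> + q) x s = diag_psi G \<rho>' g h q x s"
  by (simp_all add: diag_psi_def diag_mult_def[abs_def] rmor_dsum rphi_dsum_coord)

text \<open>The candidate in the first block is the tensor of \<rho> itself, and in the second block
  that of \<rho>' moved up by n. The interchange sends them back to the original tensors, so
  \<open>counit_tensor_eqI\<close> confirms both.\<close>

lemma counit_tensor_dsum:
  assumes g: "g \<in> carrier G"
  shows "p < rdim \<rho> \<Longrightarrow> counit_tensor G (dsum_rep \<rho> \<rho>') g p c p = counit_tensor G \<rho> g p c p"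
    and "q < rdim \<rho>' \<Longrightarrow> counit_tensor G (dsum_rep \<rho> \<rho>') g (rdim \<rho> + q) c (rdim \<rho> + q)
      = counit_tensor G \<rho>' g q c q"
proof -
  assume p: "p < rdim \<rho>"
  let ?t = "counit_tensor G \<rho> g p c"
  have t: "?t \<in> comp2 (rdim \<rho>) (rmor \<rho> g) (rmor \<rho> (inv g)) p p"
    by (rule linear_on_mem[OF r.linear_counit_tensor[OF g p] UNIV_I])
  then have "(\<lambda>k. if k < rdim \<rho> then ?t k else 0) = ?t"
    by (auto simp: comp2_def)
  then have phi: "rphi (dsum_rep \<rho> \<rho>') g (inv g) p p ?t = rphi \<rho> g (inv g) p p ?t"
    using p by (simp add: dsum_rep_simps vcomp_def dsum_interchange_def dsum_mor2_def)
  have "counit_tensor G (dsum_rep \<rho> \<rho>') g p c = ?t"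
    by (rule s.counit_tensor_eqI[OF g _ _ _ phi])
      (use p t r.counit_tensor_inverse[OF g p] in \<open>simp_all add: dsum_rep_simps comp2_dsum_first
        dsum_mat2_def dsum_mor2_def\<close>)
  then show "counit_tensor G (dsum_rep \<rho> \<rho>') g p c p = ?t p" by simp
next
  assume q: "q < rdim \<rho>'"
  let ?n = "rdim \<rho>"
  let ?t = "counit_tensor G \<rho>' g q c"
  let ?s = "\<lambda>k. if k < ?n then 0 else ?t (k - ?n)"
  have t: "?t \<in> comp2 (rdim \<rho>') (rmor \<rho>' g) (rmor \<rho>' (inv g)) q q"
    by (rule linear_on_mem[OF r'.linear_counit_tensor[OF g q] UNIV_I])
  have phi: "rphi (dsum_rep \<rho> \<rho>') g (inv g) (?n + q) (?n + q) ?s = rphi \<rho>' g (inv g) q q ?t"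
    by (simp add: dsum_rep_simps vcomp_def dsum_interchange_def dsum_mor2_def)
  have "counit_tensor G (dsum_rep \<rho> \<rho>') g (?n + q) c = ?s"
    by (rule s.counit_tensor_eqI[OF g _ _ _ phi])
      (use q t r'.counit_tensor_inverse[OF g q] in \<open>simp_all add: dsum_rep_simps comp2_dsum_second
        dsum_mat2_def dsum_mor2_def\<close>)
  then show "counit_tensor G (dsum_rep \<rho> \<rho>') g (?n + q) c (?n + q) = ?t q" by simp
qed

lemma character2_dsum:
  assumes g: "g \<in> carrier G" and h: "h \<in> carrier G" and comm: "g \<otimes> h = h \<otimes> g"
  shows "character2 G (dsum_rep \<rho> \<rho>') g h = character2 G \<rho> g h + character2 G \<rho>' g h"
proof -
  let ?n = "rdim \<rho>"
  obtain e and d :: "nat \<Rightarrow> 'a \<Rightarrow> complex" where e: "\<And>i. i < ?n \<Longrightarrow> e i \<in> rmor \<rho> h i i"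
    and d: "\<And>i. i < ?n \<Longrightarrow> linear_on UNIV UNIV (d i)"
    and ed: "\<And>i x. i < ?n \<Longrightarrow> x \<in> rmor \<rho> h i i \<Longrightarrow> x = d i x *\<^sub>C e i"
    using r.diag_frame_exists[OF h] by blast
  obtain e' and d' :: "nat \<Rightarrow> 'a \<Rightarrow> complex" where e': "\<And>i. i < rdim \<rho>' \<Longrightarrow> e' i \<in> rmor \<rho>' h i i"
    and d': "\<And>i. i < rdim \<rho>' \<Longrightarrow> linear_on UNIV UNIV (d' i)"
    and ed': "\<And>i x. i < rdim \<rho>' \<Longrightarrow> x \<in> rmor \<rho>' h i i \<Longrightarrow> x = d' i x *\<^sub>C e' i"
    using r'.diag_frame_exists[OF h] by blast
  define E where "E p = (if p < ?n then e p else e' (p - ?n))" for p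
  define D where "D p = (if p < ?n then d p else d' (p - ?n))" for p
  have c: "character2 G \<rho> g h = (\<Sum>i<?n. d i (diag_psi G \<rho> g h i (e i) (counit_tensor G \<rho> g i 1 i)))"
    by (rule r.character2_eq[OF g h comm e linear_on_mono[OF d] ed]) auto
  have c': "character2 G \<rho>' g h
      = (\<Sum>i<rdim \<rho>'. d' i (diag_psi G \<rho>' g h i (e' i) (counit_tensor G \<rho>' g i 1 i)))"
    by (rule r'.character2_eq[OF g h comm e' linear_on_mono[OF d'] ed']) auto
  have *: "E p \<in> rmor (dsum_rep \<rho> \<rho>') h p p \<and> linear_on UNIV UNIV (D p)
      \<and> (\<forall>x\<in>rmor (dsum_rep \<rho> \<rho>') h p p. x = D p x *\<^sub>C E p)" if p: "p < ?n + rdim \<rho>'" for p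
  proof (cases "p < ?n")
    case True
    then show ?thesis using e d ed by (simp add: rmor_dsum E_def D_def)
  next
    case False
    then obtain q where q: "p = ?n + q" using le_Suc_ex by (metis not_less)
    then have "q < rdim \<rho>'" using p by simp
    then show ?thesis using e' d' ed' unfolding q by (simp add: rmor_dsum E_def D_def)
  qed
  have "character2 G (dsum_rep \<rho> \<rho>') g h = (\<Sum>i<rdim (dsum_rep \<rho> \<rho>'). D i (diag_psi G (dsum_rep \<rho> \<rho>') g h i (E i)
      (counit_tensor G (dsum_rep \<rho> \<rho>') g i 1 i)))"
  proof (rule s.character2_eq[OF g h comm])
    fix i assume "i < rdim (dsum_rep \<rho> \<rho>')"
    then have i: "i < ?n + rdim \<rho>'" by (simp add: dsum_rep_simps)
    show "E i \<in> rmor (dsum_rep \<rho> \<rho>') h i i" using *[OF i] by blast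
    show "linear_on (rmor (dsum_rep \<rho> \<rho>') h i i) UNIV (D i)"
      using *[OF i] linear_on_mono by blast
    show "x = D i x *\<^sub>C E i" if "x \<in> rmor (dsum_rep \<rho> \<rho>') h i i" for x
      using *[OF i] that by blast
  qed
  then show ?thesis
    by (simp add: c c' dsum_rep_simps(1) sum_lessThan_add diag_psi_dsum counit_tensor_dsum[OF g] E_def D_def)
qed

end

section \<open>Interchange of tensor products\<close>

lemma linear_on_plus: "linear_on V UNIV f \<Longrightarrow> linear_on V UNIV g \<Longrightarrow> linear_on V UNIV (\<lambda>x. f x + g x)"
  unfolding linear_on_def by (simp add: scaleC_add_right)

text \<open>For nested lifts: the inner lift has to be bilinear in the variables of the outer one.
  On an elementary tensor it evaluates to \<beta>, which is linear in z, and sums preserve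
  this.\<close>

lemma linear_tensor_lift_param:
  assumes \<beta>: "\<And>z. bilinear_on UNIV UNIV (\<beta> z)" and lin: "\<And>v w. linear_on UNIV UNIV (\<lambda>z. \<beta> z v w)"
  shows "linear_on UNIV UNIV (\<lambda>z. tensor_lift UNIV UNIV (\<beta> z) x)"
proof -
  have l: "linear_on UNIV UNIV (tensor_lift UNIV UNIV (\<beta> z))" for z
    using linear_tensor_lift[OF _ _ \<beta>, of UNIV] by simp
  have "x \<in> tensor_space UNIV UNIV" by simp
  from this csubspace_UNIV csubspace_UNIV show ?thesis
  proof (induction rule: tensor_space_induct)
    case (tensor v w)
    then show ?case using lin by (simp add: tensor_lift_tensor[OF _ _ \<beta>])
  next
    case (add x y)
    then show ?case by (simp add: linear_on_add[OF l] linear_on_plus)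
  qed
qed

lemma
  shows linear_tensor_middle_swap: "linear_on UNIV UNIV tensor_middle_swap"
    and tensor_middle_swap_tensor:
      "tensor_middle_swap ((a \<otimes>\<^sub>v a') \<otimes>\<^sub>v (b \<otimes>\<^sub>v b')) = (a \<otimes>\<^sub>v b) \<otimes>\<^sub>v (a' \<otimes>\<^sub>v b')"
proof -
  \<comment> \<open>The lifts are treated from the inside outwards, \<open>?L1\<close> in (b, b')
    and \<open>?L2\<close> in (a, a'). The fact \<open>b4\<close> serves the evaluation in which the
    inner lift is rewritten first and b, b' stay fixed.\<close>
  let ?\<beta> = "\<lambda>a a' b b'. (a \<otimes>\<^sub>v b) \<otimes>\<^sub>v (a' \<otimes>\<^sub>v b')"
  let ?L1 = "\<lambda>u a a'. tensor_lift UNIV UNIV (?\<beta> a a') u"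
  let ?L2 = "\<lambda>s u. tensor_lift UNIV UNIV (?L1 u) s"
  have b1: "bilinear_on UNIV UNIV (?\<beta> a a')" for a a'
    by (simp add: bilinear_on_def linear_on_def tensor_bilinear)
  have l1: "linear_on UNIV UNIV (\<lambda>u. ?L1 u a a')" for a a'
    using linear_tensor_lift[OF _ _ b1, of UNIV] by simp
  have b2: "bilinear_on UNIV UNIV (?L1 u)" for u
    unfolding bilinear_on_def
    by (intro ballI conjI linear_tensor_lift_param b1) (simp_all add: linear_on_def tensor_bilinear)
  have l2: "linear_on UNIV UNIV (\<lambda>s. ?L2 s u)" for u
    using linear_tensor_lift[OF _ _ b2, of UNIV] by simp
  have b3: "bilinear_on UNIV UNIV ?L2"
    unfolding bilinear_on_def by (intro ballI conjI l2 linear_tensor_lift_param b2 l1)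
  have b4: "bilinear_on UNIV UNIV (\<lambda>a a'. ?\<beta> a a' b b')"
    by (simp add: bilinear_on_def linear_on_def tensor_bilinear)
  show "linear_on UNIV UNIV tensor_middle_swap"
    unfolding tensor_middle_swap_def using linear_tensor_lift[OF _ _ b3, of UNIV] by simp
  show "tensor_middle_swap ((a \<otimes>\<^sub>v a') \<otimes>\<^sub>v (b \<otimes>\<^sub>v b')) = (a \<otimes>\<^sub>v b) \<otimes>\<^sub>v (a' \<otimes>\<^sub>v b')"
    unfolding tensor_middle_swap_def
    by (simp add: tensor_lift_tensor[OF _ _ b3] tensor_lift_tensor[OF _ _ b2] tensor_lift_tensor[OF _ _ b1]
      tensor_lift_tensor[OF _ _ b4])
qed

lemmas tensor_middle_swap_add = linear_on_add[OF linear_tensor_middle_swap UNIV_I UNIV_I]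
  and tensor_middle_swap_scale = linear_on_scale[OF linear_tensor_middle_swap UNIV_I]
  and tensor_middle_swap_0 [simp] = linear_on_0[OF csubspace_UNIV linear_tensor_middle_swap]

text \<open>The middle swap is known explicitly only on products of two elementary tensors, so the
  induction descends into the whole tensor and then into each of its factors.\<close>

lemma tensor_space4_induct [consumes 5, case_names tensor add]:
  assumes x: "x \<in> tensor_space (tensor_space A A') (tensor_space B B')"
    and V: "csubspace A" "csubspace A'" "csubspace B" "csubspace B'"
    and tensor: "\<And>a a' b b'. a \<in> A \<Longrightarrow> a' \<in> A' \<Longrightarrow> b \<in> B \<Longrightarrow> b' \<in> B' \<Longrightarrow> P ((a \<otimes>\<^sub>v a') \<otimes>\<^sub>v (b \<otimes>\<^sub>v b'))"
    and add: "\<And>x y. P x \<Longrightarrow> P y \<Longrightarrow> P (x + y)"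
  shows "P x"
  using x csubspace_tensor_space csubspace_tensor_space
proof (induction rule: tensor_space_induct)
  case (tensor s u)
  from tensor(1) V(1,2) show ?case
  proof (induction rule: tensor_space_induct)
    case (tensor a a')
    from \<open>u \<in> tensor_space B B'\<close> V(3,4) show ?case
    proof (induction rule: tensor_space_induct)
      case (tensor b b')
      then show ?case using \<open>a \<in> A\<close> \<open>a' \<in> A'\<close> assms(6) by blast
    qed (simp add: tensor_add_right add)
  qed (simp add: tensor_add_left assms(7))
qed (rule add)

lemma tensor_middle_swap_mem:
  assumes "x \<in> tensor_space (tensor_space A A') (tensor_space B B')"
    and "csubspace A" "csubspace A'" "csubspace B" "csubspace B'"
  shows "tensor_middle_swap x \<in> tensor_space (tensor_space A B) (tensor_space A' B')"
  using assms
  by (induction rule: tensor_space4_induct)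
    (simp_all add: tensor_middle_swap_tensor tensor_middle_swap_add tensor_in_space csubspace_add)

lemma tensor_middle_swap_involution [simp]: "tensor_middle_swap (tensor_middle_swap x) = x"
proof -
  have "x \<in> tensor_space (tensor_space UNIV UNIV) (tensor_space UNIV UNIV)" by simp
  from this csubspace_UNIV csubspace_UNIV csubspace_UNIV csubspace_UNIV show ?thesis
    by (induction rule: tensor_space4_induct) (simp_all add: tensor_middle_swap_tensor tensor_middle_swap_add)
qed

lemma
  assumes f: "linear_on UNIV UNIV f" and g: "linear_on UNIV UNIV g"
  shows linear_tensor_map_UNIV: "linear_on UNIV UNIV (tensor_map UNIV UNIV f g)"
    and tensor_map_UNIV_tensor: "tensor_map UNIV UNIV f g (v \<otimes>\<^sub>v w) = f v \<otimes>\<^sub>v g w"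
  using linear_tensor_map[OF _ _ f g] tensor_map_tensor[OF _ _ f g] by simp_all

lemma tensor_map_UNIV_mem:
  assumes x: "x \<in> tensor_space V W" and V: "csubspace V" and W: "csubspace W"
    and f: "linear_on UNIV UNIV f" and g: "linear_on UNIV UNIV g"
    and fV: "\<And>v. v \<in> V \<Longrightarrow> f v \<in> V'" and gW: "\<And>w. w \<in> W \<Longrightarrow> g w \<in> W'"
  shows "tensor_map UNIV UNIV f g x \<in> tensor_space V' W'"
  using x V W
  by (induction rule: tensor_space_induct)
    (simp_all add: tensor_map_UNIV_tensor[OF f g] linear_on_add[OF linear_tensor_map_UNIV[OF f g]]
      fV gW tensor_in_space csubspace_add)

lemma linear_eval: "linear_on UNIV UNIV (\<lambda>t. t k)"
  by (rule linear_onI) (simp_all add: scaleC_fun_apply)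

text \<open>Raising n by one appends the n' positions with quotient n, whose remainders run through
  all k' below n'.\<close>

lemma sum_lessThan_mult:
  fixes f :: "nat \<Rightarrow> nat \<Rightarrow> 'a::comm_monoid_add"
  shows "(\<Sum>r<n * n'. f (r div n') (r mod n')) = (\<Sum>k<n. \<Sum>k'<n'. f k k')"
proof (induction n)
  case (Suc n)
  have "(\<Sum>r<Suc n * n'. f (r div n') (r mod n'))
      = (\<Sum>r<n * n' + n'. f (r div n') (r mod n'))" by (simp add: add.commute)
  then show ?case by (simp add: sum_lessThan_add Suc)
qed simp

lemma less_mult_div_mod:
  assumes "(p :: nat) < n * n'"
  shows "p div n' < n" "p mod n' < n'"
  using assms by (simp add: less_mult_imp_div_less, cases n') simp_all

section \<open>Invertibility of the interchange map\<close>

lemma is_mat2_tensor [simp]: "is_mat2 n (tensor_mat2 n' A A')"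
  by (simp add: is_mat2_def tensor_mat2_def)

text \<open>The coordinate at position (k, k') combines coordinate k of the left factor with
  coordinate k' of the right one and swaps the middle factors back. The value 0 beyond the last
  position is the normalisation of \<open>comp2\<close>.\<close>

definition tensor_interchange_inverse ::
    "nat \<Rightarrow> nat \<Rightarrow> (nat \<Rightarrow> ('a::complex_vector, 'b::complex_vector) tensor,
        nat \<Rightarrow> ('c::complex_vector, 'd::complex_vector) tensor) tensor
      \<Rightarrow> nat \<Rightarrow> (('a, 'c) tensor, ('b, 'd) tensor) tensor" where
  "tensor_interchange_inverse n n' s r =
     (if r < n * n' then tensor_middle_swap
        (tensor_map UNIV UNIV (\<lambda>t. t (r div n')) (\<lambda>t. t (r mod n')) s) else 0)"

lemma tensor_interchange_inverse_tensor:
  "p < n * n' \<Longrightarrow> tensor_interchange_inverse n n' (t \<otimes>\<^sub>v t') p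
    = tensor_middle_swap (t (p div n') \<otimes>\<^sub>v t' (p mod n'))"
  by (simp add: tensor_interchange_inverse_def tensor_map_UNIV_tensor[OF linear_eval linear_eval])

lemma linear_tensor_interchange:
  "linear_on UNIV UNIV (tensor_interchange n n' p q)"
  by (rule linear_onI)
    (simp_all add: tensor_interchange_def scaleC_fun_apply tensor_middle_swap_add tensor_middle_swap_scale
      linear_on_add[OF linear_tensor_map_UNIV[OF linear_coord_inj linear_coord_inj]]
      linear_on_scale[OF linear_tensor_map_UNIV[OF linear_coord_inj linear_coord_inj]]
      sum.distrib complex_vector.scale_sum_right)

lemma linear_tensor_interchange_inverse:
  "linear_on UNIV UNIV (tensor_interchange_inverse n n')"
  by (rule linear_onI)
    (simp_all add: fun_eq_iff tensor_interchange_inverse_def scaleC_fun_apply tensor_middle_swap_add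
      tensor_middle_swap_scale linear_on_add[OF linear_tensor_map_UNIV[OF linear_eval linear_eval]]
      linear_on_scale[OF linear_tensor_map_UNIV[OF linear_eval linear_eval]])

context
  fixes n n' :: nat
    and A B :: "'a::complex_vector mat2" and A' B' :: "'b::complex_vector mat2"
  assumes A: "is_mat2 n A" and B: "is_mat2 n B" and A': "is_mat2 n' A'" and B': "is_mat2 n' B'"
begin

lemma tensor_interchange_mem:
  assumes p: "p < n * n'" and q: "q < n * n'"
    and t: "t \<in> comp2 (n * n') (tensor_mat2 n' A A') (tensor_mat2 n' B B') p q"
  shows "tensor_interchange n n' p q t \<in> tensor_mat2 n' (comp2 n A B) (comp2 n' A' B') p q"
  unfolding tensor_interchange_def
proof (rule csubspace_sum)
  show "csubspace (tensor_mat2 n' (comp2 n A B) (comp2 n' A' B') p q)" by (simp add: tensor_mat2_def)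
  fix r assume "r \<in> {..<n * n'}"
  then have r: "r < n * n'" by simp
  note p' = less_mult_div_mod[OF p] and q' = less_mult_div_mod[OF q] and r' = less_mult_div_mod[OF r]
  have "tensor_middle_swap (t r) \<in> tensor_space (tensor_space (A (p div n') (r div n')) (B (r div n') (q div n')))
      (tensor_space (A' (p mod n') (r mod n')) (B' (r mod n') (q mod n')))"
    using comp2_entry[OF t r] p' q' r' unfolding tensor_mat2_def
    by (intro tensor_middle_swap_mem is_mat2D[OF A] is_mat2D[OF A'] is_mat2D[OF B] is_mat2D[OF B'])
  then show "tensor_map UNIV UNIV (coord_inj (r div n')) (coord_inj (r mod n')) (tensor_middle_swap (t r))
      \<in> tensor_mat2 n' (comp2 n A B) (comp2 n' A' B') p q"
    unfolding tensor_mat2_def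
    by (rule tensor_map_UNIV_mem[OF _ csubspace_tensor_space csubspace_tensor_space linear_coord_inj linear_coord_inj])
      (simp_all add: coord_inj_in_comp2 r')
qed

lemma tensor_interchange_inverse_mem:
  assumes p: "p < n * n'" and q: "q < n * n'"
    and s: "s \<in> tensor_mat2 n' (comp2 n A B) (comp2 n' A' B') p q"
  shows "tensor_interchange_inverse n n' s \<in> comp2 (n * n') (tensor_mat2 n' A A') (tensor_mat2 n' B B') p q"
proof -
  have "tensor_interchange_inverse n n' s r
      \<in> tensor_space (tensor_mat2 n' A A' p r) (tensor_mat2 n' B B' r q)" if r: "r < n * n'" for r
  proof -
    note p' = less_mult_div_mod[OF p] and q' = less_mult_div_mod[OF q] and r' = less_mult_div_mod[OF r]
    have "tensor_map UNIV UNIV (\<lambda>t. t (r div n')) (\<lambda>t. t (r mod n')) s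
      \<in> tensor_space (tensor_space (A (p div n') (r div n')) (B (r div n') (q div n')))
      (tensor_space (A' (p mod n') (r mod n')) (B' (r mod n') (q mod n')))"
      using s r' unfolding tensor_mat2_def
      by (intro tensor_map_UNIV_mem[OF _ csubspace_comp2 csubspace_comp2 linear_eval linear_eval])
        (auto dest: comp2_entry)
    then show ?thesis
      using p' q' r' r unfolding tensor_mat2_def tensor_interchange_inverse_def
      by (auto intro!: tensor_middle_swap_mem is_mat2D[OF A] is_mat2D[OF A'] is_mat2D[OF B] is_mat2D[OF B'])
  qed
  then show ?thesis by (auto simp: comp2_def tensor_interchange_inverse_def)
qed

lemma tensor_interchange_left_inverse:
  assumes t: "t \<in> comp2 (n * n') (tensor_mat2 n' A A') (tensor_mat2 n' B B') p q"
  shows "tensor_interchange_inverse n n' (tensor_interchange n n' p q t) = t"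
proof
  fix r
  show "tensor_interchange_inverse n n' (tensor_interchange n n' p q t) r = t r"
  proof (cases "r < n * n'")
    case r: True
    let ?\<pi> = "tensor_map UNIV UNIV (\<lambda>t. t (r div n')) (\<lambda>t. t (r mod n'))"
    let ?\<kappa> = "\<lambda>r. tensor_map UNIV UNIV (coord_inj (r div n')) (coord_inj (r mod n'))"
    \<comment> \<open>Inserting at position r' and reading at position r: if they differ, so do
      their quotients or their remainders, and one tensor factor is 0.\<close>
    have "?\<pi> (?\<kappa> r' x) = (if r' = r then x else 0)" for r' and x :: "(('a, 'a) tensor, ('b, 'b) tensor) tensor"
    proof -
      have x: "x \<in> tensor_space UNIV UNIV" by simp
      show ?thesis
      proof (cases "r' = r")
        case True
        show ?thesis
          using x csubspace_UNIV csubspace_UNIV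
          by (induction rule: tensor_space_induct)
            (simp_all add: True tensor_map_UNIV_tensor linear_eval linear_coord_inj
              linear_on_add[OF linear_tensor_map_UNIV])
      next
        case False
        then have "r div n' \<noteq> r' div n' \<or> r mod n' \<noteq> r' mod n'" by (metis div_mult_mod_eq)
        then have z: "(coord_inj (r' div n') v (r div n') :: ('a, 'a) tensor) \<otimes>\<^sub>v
            (coord_inj (r' mod n') w (r mod n') :: ('b, 'b) tensor) = 0" for v w
          by (auto simp: coord_inj_def)
        show ?thesis
          using x csubspace_UNIV csubspace_UNIV
          by (induction rule: tensor_space_induct)
            (simp_all add: False z tensor_map_UNIV_tensor linear_eval linear_coord_inj
              linear_on_add[OF linear_tensor_map_UNIV])
      qed
    qed
    then have "?\<pi> (tensor_interchange n n' p q t) = (\<Sum>r'<n * n'. if r' = r then tensor_middle_swap (t r') else 0)"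
      unfolding tensor_interchange_def
      by (simp add: linear_on_sum[OF csubspace_UNIV linear_tensor_map_UNIV[OF linear_eval linear_eval]])
    then show ?thesis using r by (simp add: tensor_interchange_inverse_def)
  qed (simp add: tensor_interchange_inverse_def comp2_outside[OF t])
qed

text \<open>On t \<otimes> t' the two swaps cancel, and the sum over positions factors into the
  coordinate expansions of t and of t'.\<close>

lemma tensor_interchange_right_inverse:
  assumes s: "s \<in> tensor_mat2 n' (comp2 n A B) (comp2 n' A' B') p q"
  shows "tensor_interchange n n' p q (tensor_interchange_inverse n n' s) = s"
  using s[unfolded tensor_mat2_def] csubspace_comp2 csubspace_comp2
proof (induction rule: tensor_space_induct)
  case (tensor t t')
  have "tensor_interchange n n' p q (tensor_interchange_inverse n n' (t \<otimes>\<^sub>v t'))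
      = (\<Sum>r<n * n'. coord_inj (r div n') (t (r div n')) \<otimes>\<^sub>v coord_inj (r mod n') (t' (r mod n')))"
    by (simp add: tensor_interchange_def tensor_interchange_inverse_tensor
        tensor_map_UNIV_tensor[OF linear_coord_inj linear_coord_inj])
  also have "\<dots> = (\<Sum>k<n. \<Sum>k'<n'. coord_inj k (t k) \<otimes>\<^sub>v coord_inj k' (t' k'))"
    by (rule sum_lessThan_mult)
  also have "\<dots> = (\<Sum>k<n. coord_inj k (t k)) \<otimes>\<^sub>v (\<Sum>k'<n'. coord_inj k' (t' k'))"
    \<comment> \<open>Expanding the left factor first yields the double sum with k outside and k'
      inside.\<close>
    by (unfold tensor_sum_left, unfold tensor_sum_right, rule refl)
  also have "\<dots> = t \<otimes>\<^sub>v t'"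
    using comp2_eq_sum[OF tensor(1)] comp2_eq_sum[OF tensor(2)] by simp
  finally show ?case .
next
  case (add x y)
  then show ?case
    by (simp only: linear_on_add[OF linear_tensor_interchange UNIV_I UNIV_I]
        linear_on_add[OF linear_tensor_interchange_inverse UNIV_I UNIV_I])
qed

lemma is_iso2_tensor_interchange:
  "is_iso2 (n * n') (comp2 (n * n') (tensor_mat2 n' A A') (tensor_mat2 n' B B'))
     (tensor_mat2 n' (comp2 n A B) (comp2 n' A' B')) (tensor_interchange n n')"
proof -
  have "linear_on (comp2 (n * n') (tensor_mat2 n' A A') (tensor_mat2 n' B B') p q)
        (tensor_mat2 n' (comp2 n A B) (comp2 n' A' B') p q) (tensor_interchange n n' p q)
      \<and> bij_betw (tensor_interchange n n' p q) (comp2 (n * n') (tensor_mat2 n' A A') (tensor_mat2 n' B B') p q)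
        (tensor_mat2 n' (comp2 n A B) (comp2 n' A' B') p q)"
    if p: "p < n * n'" and q: "q < n * n'" for p q
  proof
    show "linear_on (comp2 (n * n') (tensor_mat2 n' A A') (tensor_mat2 n' B B') p q)
        (tensor_mat2 n' (comp2 n A B) (comp2 n' A' B') p q) (tensor_interchange n n' p q)"
      using linear_tensor_interchange tensor_interchange_mem[OF p q] unfolding linear_on_def by blast
    show "bij_betw (tensor_interchange n n' p q) (comp2 (n * n') (tensor_mat2 n' A A') (tensor_mat2 n' B B') p q)
        (tensor_mat2 n' (comp2 n A B) (comp2 n' A' B') p q)"
      by (rule bij_betw_byWitness[where f' = "tensor_interchange_inverse n n'"])
        (use tensor_interchange_left_inverse tensor_interchange_right_inverse tensor_interchange_mem[OF p q]
          tensor_interchange_inverse_mem[OF p q] in auto)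
  qed
  then show ?thesis unfolding is_iso2_def is_mor2_def by blast
qed

end

section \<open>Tensor products of 2-representations\<close>

lemma is_iso2_tensor:
  assumes A: "is_mat2 n A" and B: "is_mat2 n B" and A': "is_mat2 n' A'" and B': "is_mat2 n' B'"
    and \<sigma>: "is_iso2 n A B \<sigma>" and \<sigma>': "is_iso2 n' A' B' \<sigma>'"
  shows "is_iso2 (n * n') (tensor_mat2 n' A A') (tensor_mat2 n' B B') (tensor_mor2 n' A A' \<sigma> \<sigma>')"
  unfolding is_iso2_def is_mor2_def tensor_mat2_def tensor_mor2_def
  by (intro conjI allI impI linear_tensor_map bij_betw_tensor_map is_mat2D[OF A] is_mat2D[OF B]
      is_mat2D[OF A'] is_mat2D[OF B'] is_iso2D[OF \<sigma>] is_iso2D[OF \<sigma>'])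
    (simp_all add: less_mult_div_mod)

lemma bilinear_times: "bilinear_on UNIV UNIV (\<lambda>c d :: complex. c * d)"
  by (simp add: bilinear_on_def linear_on_def scaleC_complex_def algebra_simps)

lemma tensor_lift_times: "tensor_lift UNIV UNIV (\<lambda>c d :: complex. c * d) (c \<otimes>\<^sub>v d) = c * d"
  by (simp add: tensor_lift_tensor[OF _ _ bilinear_times])

lemma linear_tensor_lift_times: "linear_on UNIV UNIV (tensor_lift UNIV UNIV (\<lambda>c d :: complex. c * d))"
  using linear_tensor_lift[OF _ _ bilinear_times, of UNIV] by simp

text \<open>On the diagonal, c \<mapsto> c \<otimes> 1 inverts multiplication. Off the diagonal two
  positions differ in quotient or remainder, so one tensor factor is 0.\<close>

lemma is_iso2_tensor_one2:
  "is_iso2 (n * n') (tensor_mat2 n' one2 one2) one2 (\<lambda>i j. tensor_lift UNIV UNIV (\<lambda>c d. c * d))"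
proof -
  let ?m = "tensor_lift UNIV UNIV (\<lambda>c d :: complex. c * d)"
  have inv: "?m s \<otimes>\<^sub>v 1 = s" for s
  proof -
    have "s \<in> tensor_space UNIV UNIV" by simp
    from this csubspace_UNIV csubspace_UNIV show ?thesis
    proof (induction rule: tensor_space_induct)
      case (tensor c d)
      have "c \<otimes>\<^sub>v (d *\<^sub>C (1::complex)) = (d *\<^sub>C c) \<otimes>\<^sub>v 1" by (simp add: tensor_scale_left tensor_scale_right)
      then show ?case by (simp add: tensor_lift_times scaleC_complex_def mult.commute)
    qed (simp add: linear_on_add[OF linear_tensor_lift_times] tensor_add_left)
  qed
  have bij: "bij_betw ?m UNIV UNIV"
    by (rule bij_betw_byWitness[where f' = "\<lambda>c. c \<otimes>\<^sub>v 1"]) (simp_all add: inv tensor_lift_times)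
  have eq: "p div n' = q div n' \<and> p mod n' = q mod n' \<longleftrightarrow> p = q" for p q :: nat
    by (metis div_mult_mod_eq)
  have 0: "?m 0 = 0" by (rule linear_on_0[OF csubspace_UNIV linear_tensor_lift_times])
  have "linear_on (tensor_mat2 n' one2 one2 p q) (one2 p q) ?m
      \<and> bij_betw ?m (tensor_mat2 n' one2 one2 p q) (one2 p q)" for p q
  proof (cases "p = q")
    case True
    then show ?thesis using bij linear_tensor_lift_times by (simp add: tensor_mat2_def one2_def)
  next
    case False
    then have "tensor_mat2 n' one2 one2 p q = {0}" "one2 p q = {0}"
      using eq[of p q] by (auto simp: tensor_mat2_def one2_def)
    then show ?thesis using 0 by (simp add: linear_on_def bij_betw_def)
  qed
  then show ?thesis unfolding is_iso2_def is_mor2_def by blast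
qed

lemma tensor_rep_simps:
  "rdim (tensor_rep G \<rho> \<rho>') = rdim \<rho> * rdim \<rho>'"
  "rmor (tensor_rep G \<rho> \<rho>') g = tensor_mat2 (rdim \<rho>') (rmor \<rho> g) (rmor \<rho>' g)"
  "rphi (tensor_rep G \<rho> \<rho>') g h =
     tensor_mor2 (rdim \<rho>') (comp2 (rdim \<rho>) (rmor \<rho> g) (rmor \<rho> h)) (comp2 (rdim \<rho>') (rmor \<rho>' g) (rmor \<rho>' h))
       (rphi \<rho> g h) (rphi \<rho>' g h) \<bullet> tensor_interchange (rdim \<rho>) (rdim \<rho>')"
  "rphi1 (tensor_rep G \<rho> \<rho>') = (\<lambda>i j. tensor_lift UNIV UNIV (\<lambda>c d. c * d))
     \<bullet> tensor_mor2 (rdim \<rho>') (rmor \<rho> \<one>\<^bsub>G\<^esub>) (rmor \<rho>' \<one>\<^bsub>G\<^esub>) (rphi1 \<rho>) (rphi1 \<rho>')"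
  by (simp_all add: tensor_rep_def Let_def)

lemma two_rep_isos_tensor:
  assumes "two_rep_isos G \<rho>" "two_rep_isos G \<rho>'"
  shows "two_rep_isos G (tensor_rep G \<rho> \<rho>')"
proof -
  interpret r: two_rep_isos G \<rho> by fact
  interpret r': two_rep_isos G \<rho>' by fact
  show ?thesis
  proof unfold_locales
    show "is_mat2 (rdim (tensor_rep G \<rho> \<rho>')) (rmor (tensor_rep G \<rho> \<rho>') g)" for g
      by (simp add: tensor_rep_simps)
    show "is_iso2 (rdim (tensor_rep G \<rho> \<rho>')) (rmor (tensor_rep G \<rho> \<rho>') \<one>\<^bsub>G\<^esub>) one2 (rphi1 (tensor_rep G \<rho> \<rho>'))"
      unfolding tensor_rep_simps
      by (rule is_iso2_vcomp[OF is_iso2_tensor is_iso2_tensor_one2])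
        (simp_all add: r.mat2 r'.mat2 r.phi1_iso r'.phi1_iso)
    fix g h assume "g \<in> carrier G" "h \<in> carrier G"
    then show "is_iso2 (rdim (tensor_rep G \<rho> \<rho>'))
        (comp2 (rdim (tensor_rep G \<rho> \<rho>')) (rmor (tensor_rep G \<rho> \<rho>') g) (rmor (tensor_rep G \<rho> \<rho>') h))
        (rmor (tensor_rep G \<rho> \<rho>') (g \<otimes>\<^bsub>G\<^esub> h)) (rphi (tensor_rep G \<rho> \<rho>') g h)"
      unfolding tensor_rep_simps
      by (intro is_iso2_vcomp[OF is_iso2_tensor_interchange is_iso2_tensor])
        (simp_all add: r.mat2 r'.mat2 r.phi_iso r'.phi_iso)
  qed
qed

context
  fixes G (structure) and \<rho> \<rho>' :: "('g, 'a::complex_vector) rep2"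
  assumes \<rho>: "two_rep_isos G \<rho>" and \<rho>': "two_rep_isos G \<rho>'"
begin

interpretation r: two_rep_isos G \<rho> by (rule \<rho>)
interpretation r': two_rep_isos G \<rho>' by (rule \<rho>')
interpretation s: two_rep_isos G "tensor_rep G \<rho> \<rho>'" by (rule two_rep_isos_tensor[OF \<rho> \<rho>'])

section \<open>Components of a tensor product\<close>

lemma rphi_tensor:
  assumes g: "g \<in> carrier G" and h: "h \<in> carrier G" and p: "p < rdim \<rho> * rdim \<rho>'"
    and i: "i = p div rdim \<rho>'" and i': "i' = p mod rdim \<rho>'"
    and t: "t \<in> comp2 (rdim \<rho>) (rmor \<rho> g) (rmor \<rho> h) i i"
    and t': "t' \<in> comp2 (rdim \<rho>') (rmor \<rho>' g) (rmor \<rho>' h) i' i'"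
    and s: "tensor_interchange (rdim \<rho>) (rdim \<rho>') p p s = t \<otimes>\<^sub>v t'"
  shows "rphi (tensor_rep G \<rho> \<rho>') g h p p s = rphi \<rho> g h i i t \<otimes>\<^sub>v rphi \<rho>' g h i' i' t'"
proof -
  have "i < rdim \<rho>" "i' < rdim \<rho>'" using p by (simp_all add: i i' less_mult_div_mod)
  then show ?thesis
    using tensor_map_tensor[OF csubspace_comp2 csubspace_comp2 r.linear_phi[OF g h] r'.linear_phi[OF g h] t t']
    by (simp add: tensor_rep_simps vcomp_def s tensor_mor2_def flip: i i')
qed

text \<open>A tensor placed at position p stays a single summand under the interchange, namely the
  elementary tensor of two vectors placed at i and i'. On such tensors \<open>rphi_tensor\<close>
  splits \<phi>.\<close>

lemma diag_mult_tensor: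
  assumes g: "g \<in> carrier G" and h: "h \<in> carrier G" and p: "p < rdim \<rho> * rdim \<rho>'"
    and i: "i = p div rdim \<rho>'" and i': "i' = p mod rdim \<rho>'"
    and a: "a \<in> rmor \<rho> g i i" and b: "b \<in> rmor \<rho> h i i"
    and a': "a' \<in> rmor \<rho>' g i' i'" and b': "b' \<in> rmor \<rho>' h i' i'"
  shows "diag_mult (tensor_rep G \<rho> \<rho>') g h p (a \<otimes>\<^sub>v a') (b \<otimes>\<^sub>v b')
    = diag_mult \<rho> g h i a b \<otimes>\<^sub>v diag_mult \<rho>' g h i' a' b'"
  unfolding diag_mult_def
proof (rule rphi_tensor[OF g h p i i'])
  have ii: "i < rdim \<rho>" "i' < rdim \<rho>'" using p by (simp_all add: i i' less_mult_div_mod)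
  show "coord_inj i (a \<otimes>\<^sub>v b) \<in> comp2 (rdim \<rho>) (rmor \<rho> g) (rmor \<rho> h) i i"
    "coord_inj i' (a' \<otimes>\<^sub>v b') \<in> comp2 (rdim \<rho>') (rmor \<rho>' g) (rmor \<rho>' h) i' i'"
    using ii a b a' b' by (simp_all add: coord_inj_in_comp2 tensor_in_space)
  let ?\<kappa> = "\<lambda>r. tensor_map UNIV UNIV (coord_inj (r div rdim \<rho>')) (coord_inj (r mod rdim \<rho>'))"
  have "tensor_interchange (rdim \<rho>) (rdim \<rho>') p p (coord_inj p (a \<otimes>\<^sub>v a' \<otimes>\<^sub>v (b \<otimes>\<^sub>v b')))
      = (\<Sum>r<rdim \<rho> * rdim \<rho>'. if r = p then ?\<kappa> p ((a \<otimes>\<^sub>v b) \<otimes>\<^sub>v (a' \<otimes>\<^sub>v b')) else 0)"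
    unfolding tensor_interchange_def
    by (rule sum.cong) (auto simp: coord_inj_def tensor_middle_swap_tensor
        linear_on_0[OF csubspace_UNIV linear_tensor_map_UNIV[OF linear_coord_inj linear_coord_inj]])
  then show "tensor_interchange (rdim \<rho>) (rdim \<rho>') p p (coord_inj p (a \<otimes>\<^sub>v a' \<otimes>\<^sub>v (b \<otimes>\<^sub>v b')))
      = coord_inj i (a \<otimes>\<^sub>v b) \<otimes>\<^sub>v coord_inj i' (a' \<otimes>\<^sub>v b')"
    using p by (simp add: tensor_map_UNIV_tensor[OF linear_coord_inj linear_coord_inj] i i')
qed

text \<open>The candidate is the preimage of the elementary tensor of the two given tensors under
  the interchange. The scalar is fixed to 1 because the units multiply: 1 * 1 = 1, while a general c
  would be squared.\<close>

lemma counit_tensor_tensor: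
  assumes g: "g \<in> carrier G" and p: "p < rdim \<rho> * rdim \<rho>'"
    and i: "i = p div rdim \<rho>'" and i': "i' = p mod rdim \<rho>'"
  shows "counit_tensor G (tensor_rep G \<rho> \<rho>') g p 1 p
    = tensor_middle_swap (counit_tensor G \<rho> g i 1 i \<otimes>\<^sub>v counit_tensor G \<rho>' g i' 1 i')"
proof -
  let ?n = "rdim \<rho>" and ?n' = "rdim \<rho>'"
  let ?t = "counit_tensor G \<rho> g i 1" and ?t' = "counit_tensor G \<rho>' g i' 1"
  let ?u = "rphi \<rho> g (inv g) i i ?t" and ?u' = "rphi \<rho>' g (inv g) i' i' ?t'"
  have k: "inv g \<in> carrier G" using g by simp
  have ii: "i < ?n" "i' < ?n'" using p by (simp_all add: i i' less_mult_div_mod)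
  have t: "?t \<in> comp2 ?n (rmor \<rho> g) (rmor \<rho> (inv g)) i i"
    and t': "?t' \<in> comp2 ?n' (rmor \<rho>' g) (rmor \<rho>' (inv g)) i' i'"
    using linear_on_mem[OF r.linear_counit_tensor[OF g ii(1)] UNIV_I] linear_on_mem[OF r'.linear_counit_tensor[OF g ii(2)] UNIV_I]
    by blast+
  note m = r.mat2[OF g] r.mat2[OF k] r'.mat2[OF g] r'.mat2[OF k]
  have tt: "?t \<otimes>\<^sub>v ?t' \<in> tensor_mat2 ?n' (comp2 ?n (rmor \<rho> g) (rmor \<rho> (inv g)))
      (comp2 ?n' (rmor \<rho>' g) (rmor \<rho>' (inv g))) p p"
    using t t' by (simp add: tensor_mat2_def tensor_in_space flip: i i')
  let ?s = "tensor_interchange_inverse ?n ?n' (?t \<otimes>\<^sub>v ?t')"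
  have s: "?s \<in> comp2 (?n * ?n') (tensor_mat2 ?n' (rmor \<rho> g) (rmor \<rho>' g))
      (tensor_mat2 ?n' (rmor \<rho> (inv g)) (rmor \<rho>' (inv g))) p p"
    by (rule tensor_interchange_inverse_mem[OF m p p tt])
  have phi: "rphi (tensor_rep G \<rho> \<rho>') g (inv g) p p ?s = ?u \<otimes>\<^sub>v ?u'"
    by (rule rphi_tensor[OF g k p i i' t t' tensor_interchange_right_inverse[OF m tt]])
  have u: "?u \<in> rmor \<rho> \<one> i i" "rphi1 \<rho> i i ?u = 1" and u': "?u' \<in> rmor \<rho>' \<one> i' i'" "rphi1 \<rho>' i' i' ?u' = 1"
    using r.counit_tensor_inverse[OF g ii(1)] r'.counit_tensor_inverse[OF g ii(2)] by simp_all
  have phi1: "rphi1 (tensor_rep G \<rho> \<rho>') p p (?u \<otimes>\<^sub>v ?u') = 1"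
    using tensor_map_tensor[OF r.space[OF r.one_closed ii(1) ii(1)] r'.space[OF r.one_closed ii(2) ii(2)]
        is_iso2D(1)[OF r.phi1_iso ii(1) ii(1)] is_iso2D(1)[OF r'.phi1_iso ii(2) ii(2)] u(1) u'(1)]
    by (simp add: tensor_rep_simps vcomp_def tensor_mor2_def tensor_lift_times u u' flip: i i')
  have "counit_tensor G (tensor_rep G \<rho> \<rho>') g p 1 = ?s"
    by (rule s.counit_tensor_eqI[OF g _ _ _ phi phi1])
      (use p s u u' in \<open>simp_all add: tensor_rep_simps, simp add: tensor_mat2_def tensor_in_space flip: i i'\<close>)
  then show ?thesis by (simp add: tensor_interchange_inverse_tensor[OF p] flip: i i')
qed

text \<open>The tensors obtained from the units need not be elementary, so s and s' are arbitrary
  and both sides are compared by linearity. On elementary tensors \<open>diag_psi\<close> is two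
  successive multiplications, each of which splits by \<open>diag_mult_tensor\<close>.\<close>

lemma diag_psi_tensor_rep:
  assumes g: "g \<in> carrier G" and h: "h \<in> carrier G" and p: "p < rdim \<rho> * rdim \<rho>'"
    and i: "i = p div rdim \<rho>'" and i': "i' = p mod rdim \<rho>'"
    and x: "x \<in> rmor \<rho> h i i" and x': "x' \<in> rmor \<rho>' h i' i'"
    and s: "s \<in> tensor_space (rmor \<rho> g i i) (rmor \<rho> (inv g) i i)"
    and s': "s' \<in> tensor_space (rmor \<rho>' g i' i') (rmor \<rho>' (inv g) i' i')"
  shows "diag_psi G (tensor_rep G \<rho> \<rho>') g h p (x \<otimes>\<^sub>v x') (tensor_middle_swap (s \<otimes>\<^sub>v s'))
    = diag_psi G \<rho> g h i x s \<otimes>\<^sub>v diag_psi G \<rho>' g h i' x' s'"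
proof -
  have k: "inv g \<in> carrier G" and hk: "h \<otimes> inv g \<in> carrier G" using g h by simp_all
  have ii: "i < rdim \<rho>" "i' < rdim \<rho>'" using p by (simp_all add: i i' less_mult_div_mod)
  have p': "p < rdim (tensor_rep G \<rho> \<rho>')" using p by (simp add: tensor_rep_simps)
  note V = r.space[OF g ii(1) ii(1)] r.space[OF k ii(1) ii(1)]
  note V' = r'.space[OF g ii(2) ii(2)] r'.space[OF k ii(2) ii(2)]
  have rmor: "rmor (tensor_rep G \<rho> \<rho>') f p p = tensor_space (rmor \<rho> f i i) (rmor \<rho>' f i' i')" for f
    by (simp add: tensor_rep_simps tensor_mat2_def flip: i i')
  have xx: "x \<otimes>\<^sub>v x' \<in> rmor (tensor_rep G \<rho> \<rho>') h p p" using x x' by (auto simp: rmor)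
  note L = s.linear_diag_psi[OF g h p' xx, unfolded rmor]
  note l = r.linear_diag_psi[OF g h ii(1) x] and l' = r'.linear_diag_psi[OF g h ii(2) x']
  \<comment> \<open>The linearity fact \<open>L\<close> holds on a subspace only, so swapped tensors
    must be shown to lie in it.\<close>
  have sw: "tensor_middle_swap (u \<otimes>\<^sub>v u')
      \<in> tensor_space (tensor_space (rmor \<rho> g i i) (rmor \<rho>' g i' i')) (tensor_space (rmor \<rho> (inv g) i i) (rmor \<rho>' (inv g) i' i'))"
    if "u \<in> tensor_space (rmor \<rho> g i i) (rmor \<rho> (inv g) i i)"
      "u' \<in> tensor_space (rmor \<rho>' g i' i') (rmor \<rho>' (inv g) i' i')" for u u'
    using that V V' by (intro tensor_middle_swap_mem tensor_in_space)
  from s V show ?thesis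
  proof (induction rule: tensor_space_induct)
    case (tensor a b)
    from s' V' show ?case
    proof (induction rule: tensor_space_induct)
      case (tensor a' b')
      note a = \<open>a \<in> rmor \<rho> g i i\<close> and b = \<open>b \<in> rmor \<rho> (inv g) i i\<close>
      note xb = linear_on_mem[OF r.linear_diag_mult[OF h k ii(1) x] b]
        and xb' = linear_on_mem[OF r'.linear_diag_mult[OF h k ii(2) x'] tensor(2)]
      have "a \<otimes>\<^sub>v a' \<in> rmor (tensor_rep G \<rho> \<rho>') g p p" "b \<otimes>\<^sub>v b' \<in> rmor (tensor_rep G \<rho> \<rho>') (inv g) p p"
        using a b tensor by (auto simp: rmor)
      then show ?case
        by (simp add: tensor_middle_swap_tensor s.diag_psi_tensor[OF g h p' xx]
            diag_mult_tensor[OF h k p i i' x b x' tensor(2)] diag_mult_tensor[OF g hk p i i' a xb tensor(1) xb']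
            r.diag_psi_tensor[OF g h ii(1) x a b] r'.diag_psi_tensor[OF g h ii(2) x' tensor])
    next
      case (add u v)
      then show ?case using tensor
        by (simp add: tensor_add_right tensor_middle_swap_add linear_on_add[OF L] sw tensor_in_space linear_on_add[OF l'])
    qed
  next
    case (add u v)
    then show ?case
      by (simp add: tensor_add_left tensor_middle_swap_add linear_on_add[OF L] sw s' linear_on_add[OF l])
  qed
qed

lemma character2_tensor:
  assumes g: "g \<in> carrier G" and h: "h \<in> carrier G" and comm: "g \<otimes> h = h \<otimes> g"
  shows "character2 G (tensor_rep G \<rho> \<rho>') g h = character2 G \<rho> g h * character2 G \<rho>' g h"
proof -
  let ?n = "rdim \<rho>" and ?n' = "rdim \<rho>'" and ?T = "tensor_rep G \<rho> \<rho>'"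
  obtain e and d :: "nat \<Rightarrow> 'a \<Rightarrow> complex" where e: "\<And>i. i < ?n \<Longrightarrow> e i \<in> rmor \<rho> h i i"
    and d: "\<And>i. i < ?n \<Longrightarrow> linear_on UNIV UNIV (d i)"
    and ed: "\<And>i x. i < ?n \<Longrightarrow> x \<in> rmor \<rho> h i i \<Longrightarrow> x = d i x *\<^sub>C e i"
    using r.diag_frame_exists[OF h] by blast
  obtain e' and d' :: "nat \<Rightarrow> 'a \<Rightarrow> complex" where e': "\<And>i. i < ?n' \<Longrightarrow> e' i \<in> rmor \<rho>' h i i"
    and d': "\<And>i. i < ?n' \<Longrightarrow> linear_on UNIV UNIV (d' i)"
    and ed': "\<And>i x. i < ?n' \<Longrightarrow> x \<in> rmor \<rho>' h i i \<Longrightarrow> x = d' i x *\<^sub>C e' i"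
    using r'.diag_frame_exists[OF h] by blast
  define E where "E p = e (p div ?n') \<otimes>\<^sub>v e' (p mod ?n')" for p
  \<comment> \<open>The product frame: on elementary tensors \<open>D p\<close> multiplies the two
    functionals, and x = D_p(x) E_p extends to sums because both sides are additive.\<close>
  define D where "D p = tensor_lift UNIV UNIV (\<lambda>x y. d (p div ?n') x * d' (p mod ?n') y)" for p
  define c where "c i = diag_psi G \<rho> g h i (e i) (counit_tensor G \<rho> g i 1 i)" for i
  define c' where "c' i = diag_psi G \<rho>' g h i (e' i) (counit_tensor G \<rho>' g i 1 i)" for i
  have chi: "character2 G \<rho> g h = (\<Sum>i<?n. d i (c i))"
    unfolding c_def by (rule r.character2_eq[OF g h comm e linear_on_mono[OF d] ed]) auto
  have chi': "character2 G \<rho>' g h = (\<Sum>i<?n'. d' i (c' i))"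
    unfolding c'_def by (rule r'.character2_eq[OF g h comm e' linear_on_mono[OF d'] ed']) auto
  have D: "linear_on UNIV UNIV (D p)" "D p (x \<otimes>\<^sub>v y) = d (p div ?n') x * d' (p mod ?n') y"
    if p: "p < ?n * ?n'" for p x y
  proof -
    have b: "bilinear_on UNIV UNIV (\<lambda>x y. d (p div ?n') x * d' (p mod ?n') y)"
      using d[OF less_mult_div_mod(1)[OF p]] d'[OF less_mult_div_mod(2)[OF p]]
      by (simp add: bilinear_on_def linear_on_def scaleC_complex_def algebra_simps)
    show "linear_on UNIV UNIV (D p)" unfolding D_def using linear_tensor_lift[OF _ _ b, of UNIV] by simp
    show "D p (x \<otimes>\<^sub>v y) = d (p div ?n') x * d' (p mod ?n') y" by (simp add: D_def tensor_lift_tensor[OF _ _ b])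
  qed
  have "character2 G ?T g h = (\<Sum>p<rdim ?T. D p (diag_psi G ?T g h p (E p) (counit_tensor G ?T g p 1 p)))"
  proof (rule s.character2_eq[OF g h comm])
    fix p assume "p < rdim ?T"
    then have p: "p < ?n * ?n'" by (simp add: tensor_rep_simps)
    note ii = less_mult_div_mod[OF p]
    have R: "rmor ?T h p p = tensor_space (rmor \<rho> h (p div ?n') (p div ?n')) (rmor \<rho>' h (p mod ?n') (p mod ?n'))"
      by (simp add: tensor_rep_simps tensor_mat2_def)
    show "E p \<in> rmor ?T h p p" using e[OF ii(1)] e'[OF ii(2)] by (auto simp: R E_def)
    show "linear_on (rmor ?T h p p) UNIV (D p)" using D(1)[OF p] by (rule linear_on_mono) auto
    show "x = D p x *\<^sub>C E p" if "x \<in> rmor ?T h p p" for x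
      using that[unfolded R] r.space[OF h ii(1) ii(1)] r'.space[OF h ii(2) ii(2)]
    proof (induction rule: tensor_space_induct)
      case (tensor v w)
      have "v \<otimes>\<^sub>v w = (d (p div ?n') v *\<^sub>C e (p div ?n')) \<otimes>\<^sub>v (d' (p mod ?n') w *\<^sub>C e' (p mod ?n'))"
        using ed[OF ii(1) tensor(1)] ed'[OF ii(2) tensor(2)] by simp
      also have "\<dots> = D p (v \<otimes>\<^sub>v w) *\<^sub>C E p"
        by (simp add: D(2)[OF p] E_def tensor_scale_left tensor_scale_right scaleC_scaleC mult.commute)
      finally show ?case .
    next
      case (add x y)
      then show ?case by (simp add: linear_on_add[OF D(1)[OF p]] scaleC_add_left)
    qed
  qed
  also have "\<dots> = (\<Sum>p<?n * ?n'. d (p div ?n') (c (p div ?n')) * d' (p mod ?n') (c' (p mod ?n')))"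
    unfolding tensor_rep_simps(1)
  proof (rule sum.cong[OF refl])
    fix p assume "p \<in> {..<?n * ?n'}"
    then have p: "p < ?n * ?n'" by simp
    note ii = less_mult_div_mod[OF p]
    show "D p (diag_psi G ?T g h p (E p) (counit_tensor G ?T g p 1 p))
        = d (p div ?n') (c (p div ?n')) * d' (p mod ?n') (c' (p mod ?n'))"
      unfolding E_def counit_tensor_tensor[OF g p refl refl] c_def c'_def
      by (simp add: diag_psi_tensor_rep[OF g h p refl refl e[OF ii(1)] e'[OF ii(2)]] D(2)[OF p]
          r.counit_tensor_entry[OF g ii(1) ii(1)] r'.counit_tensor_entry[OF g ii(2) ii(2)])
  qed
  also have "\<dots> = (\<Sum>i<?n. \<Sum>i'<?n'. d i (c i) * d' i' (c' i'))"
    by (rule sum_lessThan_mult)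
  also have "\<dots> = character2 G \<rho> g h * character2 G \<rho>' g h"
    by (simp add: chi chi' sum_product)
  finally show ?thesis .
qed

end

theorem lemma2:
  fixes G :: "('g, 'm) monoid_scheme" (structure)
    and \<rho> \<rho>' :: "('g, 'a::complex_vector) rep2"
    and g h :: 'g
  assumes "group G"
    and "two_representation G \<rho>" and "two_representation G \<rho>'"
    and "g \<in> carrier G" and "h \<in> carrier G" and "g \<otimes> h = h \<otimes> g"
  shows "character2 G (dsum_rep \<rho> \<rho>') g h = character2 G \<rho> g h + character2 G \<rho>' g h
    \<and> character2 G (tensor_rep G \<rho> \<rho>') g h = character2 G \<rho> g h * character2 G \<rho>' g h"
proof -
  note \<rho> = assms(2)[THEN two_representation.two_rep_isos] and \<rho>' = assms(3)[THEN two_representation.two_rep_isos]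
  show ?thesis
    using character2_dsum[OF \<rho> \<rho>' assms(4-6)] character2_tensor[OF \<rho> \<rho>' assms(4-6)] ..
qed

end
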